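(* Let $\alpha$ be a faithful action of a finite group $G$ on a finite set $S$, and suppose $G$ is not nilpotent. Let $\mathbb{A}(G,S,\alpha)$ be the automatic algebra whose universe is the disjoint union of $G$, $S$ and $\{0\}$, with a single binary operation $\cdot$ defined by $x\cdot y = xy$ (the image of $y$ under the action of $x$) if $x\in G$ and $y\in S$, and $x\cdot y=0$ otherwise. Then $\mathbb{A}(G,S,\alpha)$ is inherently nonfinitely based in the finite sense: for every $n\geq 1$ there exists $d\geq 1$ such that $\mathscr{V}(\mathbb{A}(G,S,\alpha))^{(n)}$ contains arbitrarily large finite $d$-generated algebras.
   Context: For a finite algebra $\mathbf{A}$ (with finitely many basic operations) and $n\geq 1$, $\mathscr{V}(\mathbf{A})^{(n)}$ denotes the class of all algebras (in the same signature) satisfying every identity in at most $n$ variables that is valid in $\mathbf{A}$. "Arbitrarily large finite $d$-generated algebras" means: for every $\ell>0$ there is a finite algebra in the class, generated by at most $d$ elements, with at least $\ell$ elements. *)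

theory Defs
  imports "HOL-Algebra.Group_Action" "HOL-Algebra.Generated_Groups"
begin

section \<open>Nilpotent groups\<close>

definition commutator_subgroup :: "('a, 'm) monoid_scheme \<Rightarrow> 'a set \<Rightarrow> 'a set \<Rightarrow> 'a set" where
  "commutator_subgroup G H K =
     generate G (\<Union>h \<in> H. \<Union>k \<in> K. {h \<otimes>\<^bsub>G\<^esub> k \<otimes>\<^bsub>G\<^esub> (inv\<^bsub>G\<^esub> h) \<otimes>\<^bsub>G\<^esub> (inv\<^bsub>G\<^esub> k)})"

fun lower_central_series :: "('a, 'm) monoid_scheme \<Rightarrow> nat \<Rightarrow> 'a set" where
  "lower_central_series G 0 = carrier G"
| "lower_central_series G (Suc i) = commutator_subgroup G (lower_central_series G i) (carrier G)"

definition nilpotent_group :: "('a, 'm) monoid_scheme \<Rightarrow> bool" where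
  "nilpotent_group G \<longleftrightarrow> group G \<and> (\<exists>c. lower_central_series G c = {\<one>\<^bsub>G\<^esub>})"


section \<open>Algebras with one binary operation\<close>

record 'a groupoid = "'a partial_object" +
  op :: "'a \<Rightarrow> 'a \<Rightarrow> 'a"  (infixl \<open>\<cdot>\<index>\<close> 70)

definition is_groupoid :: "'a groupoid \<Rightarrow> bool" where
  "is_groupoid A \<longleftrightarrow>
     carrier A \<noteq> {} \<and> (\<forall>x \<in> carrier A. \<forall>y \<in> carrier A. x \<cdot>\<^bsub>A\<^esub> y \<in> carrier A)"

inductive_set generated :: "'a groupoid \<Rightarrow> 'a set \<Rightarrow> 'a set" for A X where
  incl: "x \<in> X \<Longrightarrow> x \<in> generated A X"
| app: "x \<in> generated A X \<Longrightarrow> y \<in> generated A X \<Longrightarrow> x \<cdot>\<^bsub>A\<^esub> y \<in> generated A X"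

definition generated_by_at_most :: "nat \<Rightarrow> 'a groupoid \<Rightarrow> bool" where
  "generated_by_at_most d A \<longleftrightarrow>
     (\<exists>X \<subseteq> carrier A. finite X \<and> card X \<le> d \<and> generated A X = carrier A)"


section \<open>Identities\<close>

datatype gterm = Var nat | App gterm gterm

primrec vars :: "gterm \<Rightarrow> nat set" where
  "vars (Var i) = {i}"
| "vars (App s t) = vars s \<union> vars t"

primrec interp :: "'a groupoid \<Rightarrow> (nat \<Rightarrow> 'a) \<Rightarrow> gterm \<Rightarrow> 'a" where
  "interp A v (Var i) = v i"
| "interp A v (App s t) = interp A v s \<cdot>\<^bsub>A\<^esub> interp A v t"

definition satisfies :: "'a groupoid \<Rightarrow> gterm \<Rightarrow> gterm \<Rightarrow> bool" where
  "satisfies A s t \<longleftrightarrow> (\<forall>v. range v \<subseteq> carrier A \<longrightarrow> interp A v s = interp A v t)"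

definition variety_n :: "'a groupoid \<Rightarrow> nat \<Rightarrow> 'b groupoid set" where
  "variety_n A n =
     {B. is_groupoid B \<and>
         (\<forall>s t. card (vars s \<union> vars t) \<le> n \<longrightarrow> satisfies A s t \<longrightarrow> satisfies B s t)}"

text \<open>The witnesses have underlying type \<^typ>\<open>nat\<close>: every finite algebra is isomorphic
  to one of these, and the class above, finiteness, cardinality and the number of generators are
  invariant under isomorphism.\<close>

definition arbitrarily_large_finite_generated :: "nat \<Rightarrow> nat groupoid set \<Rightarrow> bool" where
  "arbitrarily_large_finite_generated d \<K> \<longleftrightarrow>
     (\<forall>l > 0. \<exists>B \<in> \<K>. finite (carrier B) \<and> generated_by_at_most d B \<and> card (carrier B) \<ge> l)"

definition inherently_nonfinitely_based_finite_sense :: "'a groupoid \<Rightarrow> bool" where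
  "inherently_nonfinitely_based_finite_sense A \<longleftrightarrow>
     (\<forall>n \<ge> 1. \<exists>d \<ge> 1. arbitrarily_large_finite_generated d (variety_n A n))"


section \<open>Automatic algebras\<close>

datatype ('g, 's) aut_elem = Grp 'g | Pt 's | Zero

fun aut_op :: "'g set \<Rightarrow> 's set \<Rightarrow> ('g \<Rightarrow> 's \<Rightarrow> 's) \<Rightarrow>
    ('g, 's) aut_elem \<Rightarrow> ('g, 's) aut_elem \<Rightarrow> ('g, 's) aut_elem" where
  "aut_op C S \<alpha> (Grp g) (Pt s) = (if g \<in> C \<and> s \<in> S then Pt (\<alpha> g s) else Zero)"
| "aut_op C S \<alpha> _ _ = Zero"

definition automatic_algebra ::
    "('g, 'm) monoid_scheme \<Rightarrow> 's set \<Rightarrow> ('g \<Rightarrow> 's \<Rightarrow> 's) \<Rightarrow> ('g, 's) aut_elem groupoid" where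
  "automatic_algebra G S \<alpha> =
     \<lparr>carrier = Grp ` carrier G \<union> Pt ` S \<union> {Zero}, op = aut_op (carrier G) S \<alpha>\<rparr>"

lemma (in group_action) is_groupoid_automatic_algebra:
  "is_groupoid (automatic_algebra G E \<phi>)"
proof -
  have "aut_op (carrier G) E \<phi> x y \<in> Grp ` carrier G \<union> Pt ` E \<union> {Zero}" for x y
    by (cases x; cases y) (simp_all add: element_image[OF _ _ refl])
  then show ?thesis
    by (simp add: is_groupoid_def automatic_algebra_def)
qed

end

theory Submission
  imports Defs "HOL-Algebra.Multiplicative_Group" "HOL-Number_Theory.Cong"
begin

text \<open>
  Apart from terms that are constantly zero, an identity of the automatic algebra of \<open>G\<close> is an
  equation \<open>w p = w' p\<close> with \<open>w = w'\<close> a law of \<open>G\<close> whose two sides contain the same letters.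

  A non-nilpotent finite group of least order among the sections of \<open>G\<close> contains a nontrivial
  abelian normal subgroup \<open>R\<close> on which some element \<open>y\<close> acts without fixed points and with prime
  order \<open>q\<close> (Schmidt). Substituting \<open>r \<in> R\<close> and powers of \<open>y\<close> into the laws of \<open>G\<close>,
  orthogonality of characters shows that every law holds in the wreath product of a cyclic group of
  order \<open>n\<close>, the order of \<open>r\<close>, with \<open>(\<int>/q)\<^sup>m\<close>.

  Now let \<open>e\<^sub>1, \<dots>, e\<^sub>m\<close> be the unit translations of \<open>(\<int>/q)\<^sup>m\<close>, acting on a product
  \<open>D \<times> (\<int>/q)\<^sup>m\<close>, and let \<open>x\<close> act on the fibre over \<open>(0, \<dots>, 0)\<close> by a permutation \<open>\<sigma>\<close> of
  \<open>D\<close> and on the fibre over \<open>(1, \<dots>, 1)\<close> by a permutation \<open>\<tau>\<close>, where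
  \<open>\<sigma>\<^sup>n = \<tau>\<^sup>n = 1\<close>. Any \<open>m\<close> of the \<open>m + 1\<close> letters generate a group that obeys the laws of
  \<open>G\<close>, because without \<open>e\<^sub>i\<close> the two fibres do not interact; but all letters together are
  transitive as soon as \<open>\<sigma>\<close> and \<open>\<tau>\<close> are transitive on \<open>D\<close>, which can be arbitrarily large.
\<close>

section \<open>Central series and normalizers\<close>

text \<open>The lower central series of a subgroup \<open>H\<close> is formed inside the ambient
  \<open>G\<close>, so that all subgroups share one group structure and can be compared
  directly.\<close>

fun relative_lcs :: "('a, 'm) monoid_scheme \<Rightarrow> 'a set \<Rightarrow> nat \<Rightarrow> 'a set" where
  "relative_lcs G H 0 = H"
| "relative_lcs G H (Suc i) = commutator_subgroup G (relative_lcs G H i) H"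

lemma relative_lcs_carrier: "relative_lcs G (carrier G) i = lower_central_series G i"
  by (induction i) simp_all

definition nilpotent_subset :: "('a, 'm) monoid_scheme \<Rightarrow> 'a set \<Rightarrow> bool" where
  "nilpotent_subset G H \<longleftrightarrow> (\<exists>c. relative_lcs G H c = {\<one>\<^bsub>G\<^esub>})"

context group
begin

lemma mult_inv_cancel_left:
  "x \<in> carrier G \<Longrightarrow> y \<in> carrier G \<Longrightarrow> x \<otimes> (inv x \<otimes> y) = y"
  "x \<in> carrier G \<Longrightarrow> y \<in> carrier G \<Longrightarrow> inv x \<otimes> (x \<otimes> y) = y"
  by (simp_all flip: m_assoc)

lemmas word_simps = m_assoc inv_mult_group mult_inv_cancel_left

lemma commutator_subgroup_mono:
  assumes "H \<subseteq> H'" "K \<subseteq> K'" "H' \<subseteq> carrier G" "K' \<subseteq> carrier G"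
  shows "commutator_subgroup G H K \<subseteq> commutator_subgroup G H' K'"
  unfolding commutator_subgroup_def by (rule mono_generate) (use assms in blast)

lemma commutator_subgroup_minimal:
  assumes "subgroup N G" "\<And>h k. h \<in> H \<Longrightarrow> k \<in> K \<Longrightarrow> h \<otimes> k \<otimes> inv h \<otimes> inv k \<in> N"
  shows "commutator_subgroup G H K \<subseteq> N"
  unfolding commutator_subgroup_def by (rule generate_subgroup_incl) (use assms in auto)

lemma commutator_in_commutator_subgroup:
  assumes "h \<in> H" "k \<in> K"
  shows "h \<otimes> k \<otimes> inv h \<otimes> inv k \<in> commutator_subgroup G H K"
  unfolding commutator_subgroup_def by (rule generate.incl) (use assms in blast)

lemma subgroup_commutator_subgroup:
  assumes "H \<subseteq> carrier G" "K \<subseteq> carrier G"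
  shows "subgroup (commutator_subgroup G H K) G"
  unfolding commutator_subgroup_def by (rule generate_is_subgroup) (use assms in \<open>auto simp: subset_iff\<close>)

lemma relative_lcs_Suc_subset:
  assumes "subgroup H G"
  shows "relative_lcs G H (Suc i) \<subseteq> relative_lcs G H i \<and> relative_lcs G H i \<subseteq> carrier G"
proof (induction i)
  case 0
  have "commutator_subgroup G H H \<subseteq> H"
    by (rule commutator_subgroup_minimal[OF assms])
      (simp add: assms subgroup.m_closed subgroup.m_inv_closed)
  then show ?case using subgroup.subset[OF assms] by simp
next
  case (Suc i)
  then show ?case
    using commutator_subgroup_mono[of "relative_lcs G H (Suc i)" "relative_lcs G H i" H H]
      subgroup.subset[OF assms] by auto
qed

lemma relative_lcs_antimono:
  assumes "subgroup H G" "i \<le> j"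
  shows "relative_lcs G H j \<subseteq> relative_lcs G H i"
  by (rule lift_Suc_antimono_le[of "relative_lcs G H", OF _ assms(2)])
    (use relative_lcs_Suc_subset[OF assms(1)] in blast)

lemma subgroup_relative_lcs:
  assumes "subgroup H G"
  shows "subgroup (relative_lcs G H i) G"
proof (cases i)
  case (Suc j)
  show ?thesis unfolding Suc relative_lcs.simps
    by (rule subgroup_commutator_subgroup)
      (use relative_lcs_Suc_subset[OF assms] subgroup.subset[OF assms] in auto)
qed (simp add: assms)

lemma relative_lcs_subset:
  assumes "subgroup H G"
  shows "relative_lcs G H i \<subseteq> H"
  using relative_lcs_antimono[OF assms, of 0 i] by simp

lemma commutator_in_relative_lcs:
  assumes "h \<in> relative_lcs G H i" "k \<in> H"
  shows "h \<otimes> k \<otimes> inv h \<otimes> inv k \<in> relative_lcs G H (Suc i)"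
  using commutator_in_commutator_subgroup[OF assms] by simp

text \<open>The conjugate of \<open>x\<close> by \<open>h\<close> is \<open>x\<close> times the
  commutator of \<open>inv x\<close> and \<open>h\<close>, and this commutator lies in the next,
  smaller term.\<close>

lemma relative_lcs_conj_closed:
  assumes "subgroup H G" "x \<in> relative_lcs G H i" "h \<in> H"
  shows "h \<otimes> x \<otimes> inv h \<in> relative_lcs G H i"
proof -
  interpret L: subgroup "relative_lcs G H i" G
    by (rule subgroup_relative_lcs[OF assms(1)])
  have c: "x \<in> carrier G" "h \<in> carrier G"
    using assms subgroup.mem_carrier[OF assms(1)] by auto
  have "inv x \<otimes> h \<otimes> inv (inv x) \<otimes> inv h \<in> relative_lcs G H (Suc i)"
    by (rule commutator_in_relative_lcs) (use assms in auto)
  then have "x \<otimes> (inv x \<otimes> h \<otimes> x \<otimes> inv h) \<in> relative_lcs G H i"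
    using relative_lcs_Suc_subset[OF assms(1), of i] assms(2) c
    by (intro L.m_closed[of x]) auto
  then show ?thesis using c by (simp add: word_simps)
qed

lemma normal_relative_lcs: "relative_lcs G (carrier G) i \<lhd> G"
  using relative_lcs_conj_closed[OF subgroup_self] subgroup_relative_lcs[OF subgroup_self]
  by (simp add: normal_inv_iff)

text \<open>The normalizer of \<open>I\<close>. The equivalence, in place of an implication, gives
  closure under inverses also for infinite \<open>I\<close>.\<close>

definition normalizing :: "'a set \<Rightarrow> 'a set" where
  "normalizing I = {g \<in> carrier G. \<forall>x \<in> carrier G. g \<otimes> x \<otimes> inv g \<in> I \<longleftrightarrow> x \<in> I}"

lemma subgroup_normalizing: "subgroup (normalizing I) G"
proof (rule subgroupI)
  have "\<one> \<in> normalizing I" unfolding normalizing_def by simp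
  then show "normalizing I \<noteq> {}" by blast
next
  fix a assume a: "a \<in> normalizing I"
  have "inv a \<otimes> x \<otimes> inv (inv a) \<in> I \<longleftrightarrow> x \<in> I" if x: "x \<in> carrier G" for x
  proof -
    have ac: "a \<in> carrier G" using a by (simp add: normalizing_def)
    have "a \<otimes> (inv a \<otimes> x \<otimes> a) \<otimes> inv a = x"
      using x ac by (simp add: word_simps)
    moreover have "a \<otimes> (inv a \<otimes> x \<otimes> a) \<otimes> inv a \<in> I \<longleftrightarrow> inv a \<otimes> x \<otimes> a \<in> I"
      using a x ac unfolding normalizing_def by simp
    ultimately show ?thesis using ac by simp
  qed
  then show "inv a \<in> normalizing I" 
    using a unfolding normalizing_def by simp
next
  fix a b assume a: "a \<in> normalizing I" and b: "b \<in> normalizing I"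
  then have c: "a \<in> carrier G" "b \<in> carrier G"
    unfolding normalizing_def by blast+
  have "a \<otimes> b \<otimes> x \<otimes> inv (a \<otimes> b) \<in> I \<longleftrightarrow> x \<in> I" if x: "x \<in> carrier G" for x
  proof -
    have "a \<otimes> b \<otimes> x \<otimes> inv (a \<otimes> b) = a \<otimes> (b \<otimes> x \<otimes> inv b) \<otimes> inv a"
      using x c by (simp add: m_assoc inv_mult_group)
    moreover have "b \<otimes> x \<otimes> inv b \<in> I \<longleftrightarrow> x \<in> I"
      using b x unfolding normalizing_def by blast
    moreover have "a \<otimes> (b \<otimes> x \<otimes> inv b) \<otimes> inv a \<in> I \<longleftrightarrow> b \<otimes> x \<otimes> inv b \<in> I"
      using a x c unfolding normalizing_def by simp
    ultimately show ?thesis by simp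
  qed
  then show "a \<otimes> b \<in> normalizing I" 
    using c unfolding normalizing_def by simp
next
  show "normalizing I \<subseteq> carrier G" unfolding normalizing_def by blast
qed

lemma subset_normalizing:
  assumes "subgroup I G"
  shows "I \<subseteq> normalizing I"
proof
  interpret I: subgroup I G by fact
  fix g assume g: "g \<in> I"
  have "x \<in> I" if "x \<in> carrier G" "g \<otimes> x \<otimes> inv g \<in> I" for x
  proof -
    have "inv g \<otimes> (g \<otimes> x \<otimes> inv g) \<otimes> g \<in> I" using that g by simp
    also have "inv g \<otimes> (g \<otimes> x \<otimes> inv g) \<otimes> g = x"
      using that g by (simp add: word_simps)
    finally show ?thesis .
  qed
  moreover have "g \<otimes> x \<otimes> inv g \<in> I" if "x \<in> I" for x using that g by simp
  ultimately have "\<forall>x \<in> carrier G. g \<otimes> x \<otimes> inv g \<in> I \<longleftrightarrow> x \<in> I" by metis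
  then show "g \<in> normalizing I" using g unfolding normalizing_def by simp
qed

lemma normal_if_normalizing_carrier:
  assumes "subgroup I G" "normalizing I = carrier G"
  shows "I \<lhd> G"
  unfolding normal_inv_iff
  using assms subgroup.mem_carrier[OF assms(1)] unfolding normalizing_def by blast

text \<open>Normalizers grow: the last term of the central series not contained in \<open>I\<close> normalizes \<open>I\<close>.\<close>

lemma nilpotent_normalizer_condition:
  assumes H: "subgroup H G" and nil: "nilpotent_subset G H" and I: "subgroup I G" "I \<subset> H"
  obtains h where "h \<in> H" "h \<notin> I" "h \<in> normalizing I"
proof -
  interpret I: subgroup I G by fact
  obtain c where c: "relative_lcs G H c = {\<one>}" using nil by (auto simp: nilpotent_subset_def)
  then have ex: "\<exists>c. relative_lcs G H c \<subseteq> I" by (intro exI[of _ c]) simp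
  define c0 where "c0 = (LEAST c. relative_lcs G H c \<subseteq> I)"
  have c0: "relative_lcs G H c0 \<subseteq> I" unfolding c0_def by (rule LeastI_ex[OF ex])
  have "c0 \<noteq> 0" using c0 I(2) by (metis relative_lcs.simps(1) psubsetE)
  then obtain i where i: "c0 = Suc i" by (cases c0) auto
  have "\<not> relative_lcs G H i \<subseteq> I" using not_less_Least[of i "\<lambda>c. relative_lcs G H c \<subseteq> I"] i unfolding c0_def by auto
  then obtain h where h: "h \<in> relative_lcs G H i" "h \<notin> I" by blast
  have hH: "h \<in> H" using h relative_lcs_subset[OF H] by blast
  have hc: "h \<in> carrier G" using hH subgroup.mem_carrier[OF H] by blast
  have iff: "h \<otimes> x \<otimes> inv h \<in> I \<longleftrightarrow> x \<in> I" if x: "x \<in> carrier G" for x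
  proof -
    have com: "h \<otimes> x \<otimes> inv h \<otimes> inv x \<in> I" if "x \<in> H"
      using commutator_in_relative_lcs[OF h(1) that] c0 i by auto
    have "h \<otimes> x \<otimes> inv h = (h \<otimes> x \<otimes> inv h \<otimes> inv x) \<otimes> x" using x hc by (simp add: m_assoc)
    moreover have "x = inv (h \<otimes> x \<otimes> inv h \<otimes> inv x) \<otimes> (h \<otimes> x \<otimes> inv h)"
      using x hc by (simp add: word_simps)
    \<comment> \<open>\<open>com\<close> covers only elements of \<open>H\<close>, so for the
      backward direction \<open>x\<close> is first brought into \<open>H\<close> by undoing the
      conjugation.\<close>
    moreover have "x \<in> H" if "h \<otimes> x \<otimes> inv h \<in> I"
    proof -
      have "inv h \<otimes> (h \<otimes> x \<otimes> inv h) \<otimes> h \<in> H"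
        using subgroup.m_closed[OF H subgroup.m_closed[OF H subgroup.m_inv_closed[OF H hH]
              psubsetD[OF I(2) that]] hH] .
      then show ?thesis
        using x hc by (simp add: word_simps)
    qed
    ultimately show ?thesis using com I(2) by (metis I.m_closed I.m_inv_closed psubsetD)
  qed
  have "\<forall>x \<in> carrier G. h \<otimes> x \<otimes> inv h \<in> I \<longleftrightarrow> x \<in> I" using iff by metis
  then have "h \<in> normalizing I" using hc unfolding normalizing_def by simp
  then show ?thesis using that hH h(2) by blast
qed

section \<open>Centralizers and centres of nilpotent subgroups\<close>

definition centralizing :: "'a set \<Rightarrow> 'a set" where
  "centralizing H = {x \<in> carrier G. \<forall>h \<in> H. x \<otimes> h = h \<otimes> x}"

lemma commutator_eq_one_iff:
  assumes "x \<in> carrier G" "h \<in> carrier G"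
  shows "x \<otimes> h \<otimes> inv x \<otimes> inv h = \<one> \<longleftrightarrow> x \<otimes> h = h \<otimes> x"
proof -
  have "x \<otimes> h \<otimes> inv x \<otimes> inv h = (x \<otimes> h) \<otimes> inv (h \<otimes> x)"
    using assms by (simp add: inv_mult_group m_assoc)
  then show ?thesis using assms by (metis inv_closed inv_equality inv_inv m_closed r_inv)
qed

text \<open>A nontrivial element of \<open>R\<close> is taken from the last term of the series of
  \<open>H\<close> that meets \<open>R\<close> nontrivially. Its commutators with \<open>H\<close>
  lie in \<open>R\<close> and in the next term, so they are trivial.\<close>

lemma nilpotent_normal_meets_center:
  assumes H: "subgroup H G" and nil: "nilpotent_subset G H"
    and R: "subgroup R G" "R \<noteq> {\<one>}" "R \<subseteq> H"
    and conj: "\<And>h x. h \<in> H \<Longrightarrow> x \<in> R \<Longrightarrow> h \<otimes> x \<otimes> inv h \<in> R"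
  shows "R \<inter> centralizing H \<noteq> {\<one>}"
proof -
  interpret R: subgroup R G by fact
  obtain c where c: "relative_lcs G H c = {\<one>}" using nil by (auto simp: nilpotent_subset_def)
  then have ex: "\<exists>c. R \<inter> relative_lcs G H c \<subseteq> {\<one>}" by (intro exI[of _ c]) simp
  define c0 where "c0 = (LEAST c. R \<inter> relative_lcs G H c \<subseteq> {\<one>})"
  have c0: "R \<inter> relative_lcs G H c0 \<subseteq> {\<one>}" unfolding c0_def by (rule LeastI_ex[OF ex])
  have "c0 \<noteq> 0" using c0 R R.one_closed by (metis Int_absorb2 empty_iff relative_lcs.simps(1) subset_singletonD)
  then obtain i where i: "c0 = Suc i" by (cases c0) auto
  have "\<not> R \<inter> relative_lcs G H i \<subseteq> {\<one>}" using not_less_Least[of i "\<lambda>c. R \<inter> relative_lcs G H c \<subseteq> {\<one>}"] i unfolding c0_def by auto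
  then obtain x where x: "x \<in> R" "x \<in> relative_lcs G H i" "x \<noteq> \<one>" by blast
  have "x \<otimes> h = h \<otimes> x" if h: "h \<in> H" for h
  proof -
    have hc: "h \<in> carrier G" using h subgroup.mem_carrier[OF H] by blast
    have "x \<otimes> (h \<otimes> inv x \<otimes> inv h) \<in> R" using x h by (intro R.m_closed conj) auto
    then have "x \<otimes> h \<otimes> inv x \<otimes> inv h \<in> R" using x hc by (simp add: m_assoc)
    then have "x \<otimes> h \<otimes> inv x \<otimes> inv h = \<one>"
      using commutator_in_relative_lcs[OF x(2) h] c0 i by auto
    then show ?thesis using commutator_eq_one_iff x hc by simp
  qed
  then have "x \<in> R \<inter> centralizing H" using x by (auto simp: centralizing_def)
  then show ?thesis using x by auto
qed

lemma subgroup_centralizing: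
  assumes "H \<subseteq> carrier G"
  shows "subgroup (centralizing H) G"
proof (rule subgroupI)
  show "centralizing H \<noteq> {}" using assms by (auto simp: centralizing_def subset_iff intro!: exI[of _ \<one>])
next
  fix a assume a: "a \<in> centralizing H"
  have "inv a \<otimes> h = h \<otimes> inv a" if "h \<in> H" for h
  proof -
    have "h \<in> carrier G" "a \<in> carrier G" "a \<otimes> h = h \<otimes> a"
      using a that assms by (auto simp: centralizing_def)
    then show ?thesis by (metis inv_closed inv_solve_left inv_solve_right m_assoc m_closed)
  qed
  then show "inv a \<in> centralizing H" using a by (simp add: centralizing_def)
next
  fix a b assume a: "a \<in> centralizing H" and b: "b \<in> centralizing H"
  have "a \<otimes> b \<otimes> h = h \<otimes> (a \<otimes> b)" if "h \<in> H" for h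
  proof -
    have "h \<in> carrier G" "a \<in> carrier G" "a \<otimes> h = h \<otimes> a" "b \<in> carrier G" "b \<otimes> h = h \<otimes> b"
      using a b that assms by (auto simp: centralizing_def)
    then show ?thesis by (metis m_assoc)
  qed
  then show "a \<otimes> b \<in> centralizing H" using a b by (simp add: centralizing_def)
qed (auto simp: centralizing_def)

lemma centralizing_conj_closed:
  assumes "H \<lhd> G" "x \<in> centralizing H" "g \<in> carrier G"
  shows "g \<otimes> x \<otimes> inv g \<in> centralizing H"
proof -
  have xc: "x \<in> carrier G" using assms by (simp add: centralizing_def)
  have "g \<otimes> x \<otimes> inv g \<otimes> h = h \<otimes> (g \<otimes> x \<otimes> inv g)" if h: "h \<in> H" for h
  proof -
    have hc: "h \<in> carrier G" by (rule subgroup.mem_carrier[OF normal_imp_subgroup[OF assms(1)] h])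
    have "inv g \<otimes> h \<otimes> inv (inv g) \<in> H" 
      using assms(1) h inv_closed[OF assms(3)] unfolding normal_inv_iff by blast
    then have "x \<otimes> (inv g \<otimes> h \<otimes> g) = (inv g \<otimes> h \<otimes> g) \<otimes> x"
      using assms by (simp add: centralizing_def)
    then have "g \<otimes> (x \<otimes> (inv g \<otimes> h \<otimes> g)) \<otimes> inv g = g \<otimes> ((inv g \<otimes> h \<otimes> g) \<otimes> x) \<otimes> inv g"
      by simp
    then show ?thesis using xc hc assms(3) by (simp add: word_simps)
  qed
  then show ?thesis using xc assms(3) by (simp add: centralizing_def)
qed

end

section \<open>Maximal subgroups and Schmidt's theorem\<close>

context group
begin

definition maximal_subgroup :: "'a set \<Rightarrow> bool" where
  "maximal_subgroup M \<longleftrightarrow> subgroup M G \<and> M \<noteq> carrier G \<and>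
     (\<forall>H. subgroup H G \<longrightarrow> M \<subseteq> H \<longrightarrow> H = M \<or> H = carrier G)"

lemma exists_maximal_subgroup_above:
  assumes fin: "finite (carrier G)" and H: "subgroup H G" "H \<noteq> carrier G"
  obtains M where "maximal_subgroup M" "H \<subseteq> M"
proof -
  let ?P = "{K. subgroup K G \<and> K \<noteq> carrier G}"
  have "?P \<subseteq> Pow (carrier G)" using subgroup.subset by blast
  then have "finite ?P" by (rule finite_subset) (use fin in simp)
  then obtain M where M: "M \<in> ?P" "H \<subseteq> M" "\<forall>K \<in> ?P. M \<subseteq> K \<longrightarrow> M = K"
    using finite_has_maximal2[of ?P H] H by auto
  have "maximal_subgroup M" unfolding maximal_subgroup_def using M by blast
  then show ?thesis using that M by blast
qed

lemma subgroup_conj_image: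
  assumes "subgroup H G" "g \<in> carrier G"
  shows "subgroup ((\<lambda>x. g \<otimes> x \<otimes> inv g) ` H) G"
proof (rule subgroupI)
  interpret H: subgroup H G by fact
  show "(\<lambda>x. g \<otimes> x \<otimes> inv g) ` H \<subseteq> carrier G" using assms by auto
  show "(\<lambda>x. g \<otimes> x \<otimes> inv g) ` H \<noteq> {}" using H.one_closed by blast
  show "inv a \<in> (\<lambda>x. g \<otimes> x \<otimes> inv g) ` H" if "a \<in> (\<lambda>x. g \<otimes> x \<otimes> inv g) ` H" for a
  proof -
    obtain x where x: "x \<in> H" "a = g \<otimes> x \<otimes> inv g" using \<open>a \<in> _\<close> by blast
    then have "inv a = g \<otimes> inv x \<otimes> inv g" using assms by (simp add: word_simps)
    then show ?thesis using x by blast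
  qed
  show "a \<otimes> b \<in> (\<lambda>x. g \<otimes> x \<otimes> inv g) ` H"
    if "a \<in> (\<lambda>x. g \<otimes> x \<otimes> inv g) ` H" "b \<in> (\<lambda>x. g \<otimes> x \<otimes> inv g) ` H" for a b
  proof -
    obtain x where x: "x \<in> H" "a = g \<otimes> x \<otimes> inv g" using \<open>a \<in> _\<close> by blast
    obtain y where y: "y \<in> H" "b = g \<otimes> y \<otimes> inv g" using \<open>b \<in> _\<close> by blast
    have "a \<otimes> b = g \<otimes> (x \<otimes> y) \<otimes> inv g" using x y assms by (simp add: word_simps)
    then show ?thesis using x y by blast
  qed
qed

lemma conj_image_conj_image:
  assumes "H \<subseteq> carrier G" "g \<in> carrier G"
  shows "(\<lambda>x. g \<otimes> x \<otimes> inv g) ` (\<lambda>x. inv g \<otimes> x \<otimes> g) ` H = H"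
proof -
  have "g \<otimes> (inv g \<otimes> x \<otimes> g) \<otimes> inv g = x" if "x \<in> H" for x
    using that assms by (simp add: word_simps subset_iff)
  then show ?thesis by (simp add: image_image)
qed

lemma maximal_subgroup_conj_image:
  assumes "maximal_subgroup M" "g \<in> carrier G"
  shows "maximal_subgroup ((\<lambda>x. g \<otimes> x \<otimes> inv g) ` M)"
proof -
  let ?c = "\<lambda>x. g \<otimes> x \<otimes> inv g" and ?d = "\<lambda>x. inv g \<otimes> x \<otimes> g"
  have M: "subgroup M G" "M \<noteq> carrier G"
    "\<And>H. subgroup H G \<Longrightarrow> M \<subseteq> H \<Longrightarrow> H = M \<or> H = carrier G"
    using assms(1) by (auto simp: maximal_subgroup_def)
  have cd: "?c ` ?d ` H = H" if "H \<subseteq> carrier G" for H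
    by (rule conj_image_conj_image[OF that assms(2)])
  have dc: "?d ` ?c ` H = H" if "H \<subseteq> carrier G" for H
    using conj_image_conj_image[OF that inv_closed[OF assms(2)]] assms(2) by simp
  have sd: "subgroup (?d ` H) G" if "subgroup H G" for H
    using subgroup_conj_image[OF that inv_closed[OF assms(2)]] assms(2) by simp
  have full: "?c ` carrier G = carrier G"
  proof
    show "?c ` carrier G \<subseteq> carrier G" using assms(2) by auto
    have "?d ` carrier G \<subseteq> carrier G" using assms(2) by auto
    then show "carrier G \<subseteq> ?c ` carrier G" using cd[of "carrier G"] by blast
  qed
  have Ms: "M \<subseteq> carrier G" by (rule subgroup.subset[OF M(1)])
  have "?c ` M \<noteq> carrier G"
    using dc[OF Ms] dc[of "carrier G"] full M(2) by (metis order_refl)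
  moreover have "H = ?c ` M \<or> H = carrier G" if H: "subgroup H G" "?c ` M \<subseteq> H" for H
  proof -
    have Hs: "H \<subseteq> carrier G" by (rule subgroup.subset[OF H(1)])
    have "M \<subseteq> ?d ` H" using dc[OF Ms] H(2) by (metis image_mono)
    then have "?d ` H = M \<or> ?d ` H = carrier G" using M(3) sd[OF H(1)] by blast
    then show ?thesis using cd[OF Hs] full by metis
  qed
  ultimately show ?thesis
    using subgroup_conj_image[OF M(1) assms(2)] by (auto simp: maximal_subgroup_def)
qed

text \<open>With \<open>inv g\<close> on the left, the conjugate depends only on the right coset
  \<open>M #> g\<close>; the count below runs over these cosets.\<close>

definition conjugates_union :: "'a set \<Rightarrow> 'a set" where
  "conjugates_union M = (\<Union>g \<in> carrier G. (\<lambda>x. inv g \<otimes> x \<otimes> g) ` (M - {\<one>}))"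

text \<open>By \<open>ti\<close>, conjugates that belong to distinct right cosets of
  \<open>M\<close> meet trivially. Each coset thus contributes \<open>card M - 1\<close> elements of
  its own; the factor \<open>card M\<close> on the left avoids dividing by it.\<close>

lemma card_conjugates_union:
  assumes fin: "finite (carrier G)" and M: "subgroup M G"
    and ti: "\<And>g x. g \<in> carrier G \<Longrightarrow> x \<in> M \<Longrightarrow> x \<noteq> \<one> \<Longrightarrow> g \<otimes> x \<otimes> inv g \<in> M \<Longrightarrow> g \<in> M"
  shows "card (conjugates_union M) * card M = order G * (card M - 1)"
proof -
  interpret M: subgroup M G by fact
  define F where "F C = (\<Union>g \<in> C. (\<lambda>x. inv g \<otimes> x \<otimes> g) ` (M - {\<one>}))" for C
  have finM: "finite M" using fin M.subset finite_subset by blast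
  have F_coset: "F (M #> a) = (\<lambda>x. inv a \<otimes> x \<otimes> a) ` (M - {\<one>})" if a: "a \<in> carrier G" for a
  proof
    show "F (M #> a) \<subseteq> (\<lambda>x. inv a \<otimes> x \<otimes> a) ` (M - {\<one>})"
    proof
      fix z assume "z \<in> F (M #> a)"
      then obtain m x where mx: "m \<in> M" "x \<in> M" "x \<noteq> \<one>" "z = inv (m \<otimes> a) \<otimes> x \<otimes> (m \<otimes> a)"
        by (auto simp: F_def r_coset_def)
      have "inv m \<otimes> x \<otimes> m \<noteq> \<one>"
      proof
        assume "inv m \<otimes> x \<otimes> m = \<one>"
        then have "m \<otimes> (inv m \<otimes> x \<otimes> m) \<otimes> inv m = m \<otimes> \<one> \<otimes> inv m" by simp
        then show False using mx by (simp add: word_simps)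
      qed
      moreover have "inv m \<otimes> x \<otimes> m \<in> M" using mx by simp
      moreover have "z = inv a \<otimes> (inv m \<otimes> x \<otimes> m) \<otimes> a" using mx a by (simp add: word_simps)
      ultimately show "z \<in> (\<lambda>x. inv a \<otimes> x \<otimes> a) ` (M - {\<one>})" by blast
    qed
    have "a \<in> M #> a" using a by (rule rcos_self[OF _ M])
    then show "(\<lambda>x. inv a \<otimes> x \<otimes> a) ` (M - {\<one>}) \<subseteq> F (M #> a)" unfolding F_def by blast
  qed
  have cardF: "card (F C) = card M - 1" if C: "C \<in> rcosets M" for C
  proof -
    obtain a where a: "a \<in> carrier G" "C = M #> a" using C by (auto simp: RCOSETS_def)
    have "inj_on (\<lambda>x. inv a \<otimes> x \<otimes> a) (M - {\<one>})"
      using a by (intro inj_onI) (simp add: m_assoc)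
    then have "card (F C) = card (M - {\<one>})" using a F_coset by (simp add: card_image)
    then show ?thesis using M.one_closed finM by simp
  qed
  have disj: "F C \<inter> F D = {}" if C: "C \<in> rcosets M" and D: "D \<in> rcosets M" and "C \<noteq> D" for C D
  proof (rule ccontr)
    obtain a where a: "a \<in> carrier G" "C = M #> a" using C by (auto simp: RCOSETS_def)
    obtain b where b: "b \<in> carrier G" "D = M #> b" using D by (auto simp: RCOSETS_def)
    assume "F C \<inter> F D \<noteq> {}"
    then obtain x y where xy: "x \<in> M" "x \<noteq> \<one>" "y \<in> M" "inv a \<otimes> x \<otimes> a = inv b \<otimes> y \<otimes> b"
      unfolding a(2) b(2) F_coset[OF a(1)] F_coset[OF b(1)] by blast
    have "(b \<otimes> inv a) \<otimes> x \<otimes> inv (b \<otimes> inv a) = b \<otimes> (inv a \<otimes> x \<otimes> a) \<otimes> inv b"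
      using a(1) b(1) xy(1) by (simp add: word_simps)
    also have "\<dots> = y" unfolding xy(4) using b(1) xy(3) by (simp add: word_simps)
    finally have "b \<otimes> inv a \<in> M" using ti[of "b \<otimes> inv a" x] a b xy by simp
    then have "b \<in> M #> a" unfolding r_coset_def using a b
      by (auto simp: word_simps intro!: bexI[of _ "b \<otimes> inv a"])
    then show False using repr_independence[OF _ a(1) M] a b \<open>C \<noteq> D\<close> by blast
  qed
  have U: "conjugates_union M = (\<Union>C \<in> rcosets M. F C)"
    unfolding conjugates_union_def F_def rcosets_part_G[OF M, symmetric] by blast
  have finr: "finite (rcosets M)" using fin by (auto simp: RCOSETS_def)
  have finF: "finite (F C)" if "C \<in> rcosets M" for C
    using that F_coset finM by (auto simp: RCOSETS_def)
  have "card (conjugates_union M) = (\<Sum>C \<in> rcosets M. card (F C))"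
    unfolding U by (rule card_UN_disjoint) (use finr finF disj in auto)
  also have "\<dots> = card (rcosets M) * (card M - 1)" using cardF by simp
  finally have "card (conjugates_union M) * card M = (card (rcosets M) * card M) * (card M - 1)"
    by simp
  then show ?thesis using lagrange_finite[OF fin M] by simp
qed

text \<open>Schmidt's theorem. In a simple group all of whose proper subgroups are nilpotent, distinct
  maximal subgroups intersect trivially because normalizers grow; then the conjugates of two
  non-conjugate maximal subgroups are too numerous to fit into the group.\<close>

lemma exists_normal_if_proper_subgroups_nilpotent:
  assumes fin: "finite (carrier G)"
    and nil: "\<And>H. subgroup H G \<Longrightarrow> H \<noteq> carrier G \<Longrightarrow> nilpotent_subset G H"
    and noncomm: "\<not> comm_group G"
  shows "\<exists>N. N \<lhd> G \<and> N \<noteq> {\<one>} \<and> N \<noteq> carrier G"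
proof (rule ccontr)
  assume "\<not> ?thesis"
  then have simple: "N = {\<one>} \<or> N = carrier G" if "N \<lhd> G" for N using that by blast
  have triv_int: "M1 \<inter> M2 = {\<one>}"
    if "maximal_subgroup M1" "maximal_subgroup M2" "M1 \<noteq> M2" for M1 M2
  proof (rule ccontr)
    assume ne: "M1 \<inter> M2 \<noteq> {\<one>}"
    \<comment> \<open>Among the pairs of distinct maximal subgroups with nontrivial intersection,
      one with the largest intersection is chosen.\<close>
    let ?P = "\<lambda>(M1, M2). maximal_subgroup M1 \<and> maximal_subgroup M2 \<and> M1 \<noteq> M2 \<and> M1 \<inter> M2 \<noteq> {\<one>}"
    let ?f = "\<lambda>(M1, M2). card (M1 \<inter> M2)"
    have maxsub: "M \<subseteq> carrier G" "subgroup M G" if "maximal_subgroup M" for M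
      using that subgroup.subset by (auto simp: maximal_subgroup_def)
    have "\<exists>x. ?P x \<and> (\<forall>y. ?P y \<longrightarrow> ?f y \<le> ?f x)"
    proof (rule ex_has_greatest_nat[of ?P "(M1, M2)"])
      show "?P (M1, M2)" using that ne by simp
      show "\<forall>y. ?P y \<longrightarrow> ?f y < Suc (card (carrier G))"
        using fin maxsub(1) by (auto simp: less_Suc_eq_le intro!: card_mono)
    qed
    then obtain p where p: "?P p" "\<forall>y. ?P y \<longrightarrow> ?f y \<le> ?f p" by blast
    obtain A B where "p = (A, B)" by (cases p)
    then have AB: "maximal_subgroup A" "maximal_subgroup B" "A \<noteq> B" "A \<inter> B \<noteq> {\<one>}"
      and max: "\<And>C D. maximal_subgroup C \<Longrightarrow> maximal_subgroup D \<Longrightarrow> C \<noteq> D \<Longrightarrow> C \<inter> D \<noteq> {\<one>} \<Longrightarrow>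
        card (C \<inter> D) \<le> card (A \<inter> B)" using p by simp_all
    define I where "I = A \<inter> B"
    have I: "subgroup I G" unfolding I_def using AB maxsub by (intro subgroups_Inter_pair) auto
    have "\<not> A \<subseteq> B" "\<not> B \<subseteq> A" using AB by (auto simp: maximal_subgroup_def)
    then have sub: "I \<subset> A" "I \<subset> B" by (auto simp: I_def)
    have nilAB: "nilpotent_subset G A" "nilpotent_subset G B"
      using AB nil by (auto simp: maximal_subgroup_def)
    obtain a where a: "a \<in> A" "a \<notin> I" "a \<in> normalizing I"
      using nilpotent_normalizer_condition[OF maxsub(2)[OF AB(1)] nilAB(1) I sub(1)] by blast
    obtain b where b: "b \<in> B" "b \<notin> I" "b \<in> normalizing I"
      using nilpotent_normalizer_condition[OF maxsub(2)[OF AB(2)] nilAB(2) I sub(2)] by blast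
    have "normalizing I \<noteq> carrier G"
    proof
      assume "normalizing I = carrier G"
      then have "I = {\<one>} \<or> I = carrier G" using simple normal_if_normalizing_carrier[OF I] by blast
      then show False using AB(4) sub(1) maxsub[OF AB(1)] by (auto simp: I_def)
    qed
    then obtain M where M: "maximal_subgroup M" "normalizing I \<subseteq> M"
      using exists_maximal_subgroup_above[OF fin subgroup_normalizing] by blast
    \<comment> \<open>\<open>M\<close> and \<open>C\<close> share \<open>I\<close> and
      \<open>c\<close>, hence more than \<open>I\<close>, so they coincide by the choice of the
      pair. As normalizers grow, both \<open>A\<close> and \<open>B\<close> qualify as
      \<open>C\<close>, which forces \<open>A = B\<close>.\<close>
    have "M = C" if C: "maximal_subgroup C" "I \<subseteq> C" "c \<in> C" "c \<notin> I" "c \<in> normalizing I" for C c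
    proof (rule ccontr)
      assume "M \<noteq> C"
      have IMC: "insert c I \<subseteq> M \<inter> C" using C M subset_normalizing[OF I] by blast
      then have "I \<subset> M \<inter> C" using C(4) by blast
      moreover have "finite (M \<inter> C)" using maxsub(1)[OF M(1)] fin finite_subset by blast
      ultimately have "card I < card (M \<inter> C)" using psubset_card_mono by blast
      moreover have "c \<noteq> \<one>" using C(4) subgroup.one_closed[OF I] by metis
      then have "M \<inter> C \<noteq> {\<one>}" using IMC by (metis insert_subset singletonD)
      ultimately show False using max[OF M(1) C(1) \<open>M \<noteq> C\<close>] by (simp add: I_def)
    qed
    then have "M = A" "M = B" using AB a b sub by blast+
    then show False using AB by simp
  qed
  have nc: "normalizing M = M" if M: "maximal_subgroup M" "M \<noteq> {\<one>}" for M
  proof -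
    have s: "subgroup M G" using M by (simp add: maximal_subgroup_def)
    have "normalizing M \<noteq> carrier G"
      using normal_if_normalizing_carrier[OF s] simple M by (auto simp: maximal_subgroup_def)
    then show ?thesis
      using M subset_normalizing[OF s] subgroup_normalizing by (auto simp: maximal_subgroup_def)
  qed
  have cov: "\<exists>M. maximal_subgroup M \<and> x \<in> M" if x: "x \<in> carrier G" for x
  proof -
    have "generate G {x} \<noteq> carrier G"
    proof
      assume gen: "generate G {x} = carrier G"
      have "comm_group G"
      proof (rule group_comm_groupI)
        fix u v assume "u \<in> carrier G" "v \<in> carrier G"
        then obtain i j :: int where "u = x [^] i" "v = x [^] j"
          using generate_pow[OF x] gen by blast
        then show "u \<otimes> v = v \<otimes> u" using x by (simp add: int_pow_mult[symmetric] add.commute)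
      qed
      then show False using noncomm by simp
    qed
    then obtain M where "maximal_subgroup M" "generate G {x} \<subseteq> M"
      using exists_maximal_subgroup_above[OF fin generate_is_subgroup] x by blast
    then show ?thesis using generate.incl[of x "{x}" G] by blast
  qed
  have maxmem: "x \<in> carrier G" if "maximal_subgroup M" "x \<in> M" for M x
    using that subgroup.mem_carrier unfolding maximal_subgroup_def by metis
  \<comment> \<open>A conjugate of \<open>M\<close> that meets \<open>M\<close> nontrivially equals
    \<open>M\<close> by \<open>triv_int\<close>; so \<open>g\<close> normalizes \<open>M\<close> and
    lies in it by \<open>nc\<close>.\<close>
  have ti: "g \<in> M" if M: "maximal_subgroup M" and g: "g \<in> carrier G"
    and x: "x \<in> M" "x \<noteq> \<one>" "g \<otimes> x \<otimes> inv g \<in> M" for M g x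
  proof -
    let ?c = "\<lambda>x. g \<otimes> x \<otimes> inv g"
    have s: "subgroup M G" using M by (simp add: maximal_subgroup_def)
    then have xc: "x \<in> carrier G" using x(1) by (rule subgroup.mem_carrier)
    have "?c x \<noteq> \<one>"
    proof
      assume "?c x = \<one>"
      then have "inv g \<otimes> ?c x \<otimes> g = inv g \<otimes> \<one> \<otimes> g" by simp
      then show False using x g xc by (simp add: word_simps)
    qed
    then have "?c ` M \<inter> M \<noteq> {\<one>}" using x by blast
    then have eq: "?c ` M = M" using triv_int[OF maximal_subgroup_conj_image[OF M g] M] by blast
    have "(?c z \<in> M) = (z \<in> M)" if z: "z \<in> carrier G" for z
    proof
      assume "?c z \<in> M"
      then have "?c z \<in> ?c ` M" by (simp only: eq)
      then obtain w where w: "w \<in> M" "?c z = ?c w" by (rule imageE)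
      then have "z = w" using z g subgroup.mem_carrier[OF s w(1)] by simp
      then show "z \<in> M" using w by simp
    qed (use eq in blast)
    then have "g \<in> normalizing M" using g unfolding normalizing_def by simp
    then show ?thesis using nc[OF M] x by blast
  qed
  \<comment> \<open>The size of the union is the order of \<open>G\<close> minus the index of
    \<open>M\<close>. The index is at most half the order since \<open>card M \<ge> 2\<close>, and
    greater than 1 since \<open>M\<close> is proper.\<close>
  have big: "order G \<le> 2 * card (conjugates_union M)" "card (conjugates_union M) + 1 < order G"
    if M: "maximal_subgroup M" "M \<noteq> {\<one>}" for M
  proof -
    have s: "subgroup M G" "M \<noteq> carrier G" using M by (auto simp: maximal_subgroup_def)
    have ms: "M \<subseteq> carrier G" by (rule subgroup.subset[OF s(1)])
    have fM: "finite M" using ms fin finite_subset by blast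
    have "{\<one>} \<subset> M" using M(2) subgroup.one_closed[OF s(1)] by blast
    from psubset_card_mono[OF fM this] have c2: "card M \<ge> 2" by simp
    have lt: "card M < order G" unfolding order_def using ms s(2) fin by (simp add: psubset_card_mono psubsetI)
    define u where "u = card (conjugates_union M)"
    have eq: "u * card M = order G * (card M - 1)"
      unfolding u_def by (rule card_conjugates_union[OF fin s(1)]) (rule ti[OF M(1)])
    obtain k where k: "card M = Suc (Suc k)" using c2 by (metis add_2_eq_Suc le_Suc_ex)
    have "order G * card M \<le> (2 * u) * card M"
    proof -
      have "order G * card M \<le> order G * (2 * (card M - 1))" using k by (intro mult_left_mono) auto
      also have "\<dots> = 2 * (order G * (card M - 1))" by simp
      finally show ?thesis unfolding eq[symmetric] by simp
    qed
    then show "order G \<le> 2 * card (conjugates_union M)" using c2 by (simp add: u_def)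
    have "u * card M + order G = order G * card M" using eq k by (simp add: algebra_simps)
    then have "(u + 1) * card M < order G * card M" using lt by (simp add: algebra_simps)
    then show "card (conjugates_union M) + 1 < order G" unfolding u_def by (rule mult_less_cancel2[THEN iffD1, THEN conjunct2])
  qed
  have one_not: "\<one> \<notin> conjugates_union M" if M: "maximal_subgroup M" for M
  proof
    assume "\<one> \<in> conjugates_union M"
    then obtain g x where g: "g \<in> carrier G" "x \<in> M" "x \<noteq> \<one>" "\<one> = inv g \<otimes> x \<otimes> g"
      unfolding conjugates_union_def by blast
    have xc: "x \<in> carrier G" by (rule maxmem[OF M g(2)])
    have "g \<otimes> \<one> \<otimes> inv g = g \<otimes> (inv g \<otimes> x \<otimes> g) \<otimes> inv g"
      by (simp only: g(4)[symmetric])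
    also have "\<dots> = x" using g(1) xc by (simp add: word_simps)
    finally show False using g(1,3) by simp
  qed
  have sub: "conjugates_union M \<subseteq> carrier G" if M: "maximal_subgroup M" for M
    using maxmem[OF M] by (auto simp: conjugates_union_def)
  have "carrier G \<noteq> {\<one>}"
  proof
    assume "carrier G = {\<one>}"
    then have "comm_group G" by (intro group_comm_groupI) auto
    then show False using noncomm by simp
  qed
  then obtain x where x: "x \<in> carrier G" "x \<noteq> \<one>" by blast
  obtain M where M: "maximal_subgroup M" "M \<noteq> {\<one>}" using cov[OF x(1)] x(2) by blast
  \<comment> \<open>The second bound leaves a nontrivial \<open>z\<close> outside all conjugates of
    \<open>M\<close>; a maximal subgroup \<open>L\<close> through \<open>z\<close> is then not
    conjugate to \<open>M\<close>.\<close>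
  have "card (insert \<one> (conjugates_union M)) < card (carrier G)"
    using big(2)[OF M] one_not[OF M(1)] finite_subset[OF sub[OF M(1)] fin] by (simp add: order_def)
  then have "\<not> carrier G \<subseteq> insert \<one> (conjugates_union M)"
    using finite_subset[OF sub[OF M(1)] fin] by (meson card_mono finite.insertI not_le)
  then obtain z where z: "z \<in> carrier G" "z \<noteq> \<one>" "z \<notin> conjugates_union M" by blast
  obtain L where L: "maximal_subgroup L" "z \<in> L" using cov[OF z(1)] by blast
  then have L1: "L \<noteq> {\<one>}" using z by blast
  \<comment> \<open>A common element would make the conjugate of \<open>L\<close> by
    \<open>k\<close> equal to \<open>M\<close> and put \<open>z\<close> into a conjugate of
    \<open>M\<close>. Two disjoint unions, each at least half of the group, leave no room for the
    identity.\<close>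
  have "conjugates_union M \<inter> conjugates_union L = {}"
  proof (rule ccontr)
    assume "conjugates_union M \<inter> conjugates_union L \<noteq> {}"
    then obtain g x h y where *: "g \<in> carrier G" "x \<in> M" "x \<noteq> \<one>" "h \<in> carrier G" "y \<in> L" "y \<noteq> \<one>"
      and e: "inv g \<otimes> x \<otimes> g = inv h \<otimes> y \<otimes> h"
      unfolding conjugates_union_def by blast
    have c: "x \<in> carrier G" "y \<in> carrier G"
      using * M L maxmem by blast+
    define k where "k = g \<otimes> inv h"
    have kc: "k \<in> carrier G" using * by (simp add: k_def)
    have "k \<otimes> y \<otimes> inv k = g \<otimes> (inv h \<otimes> y \<otimes> h) \<otimes> inv g"
      using * c by (simp add: k_def word_simps)
    also have "\<dots> = x" unfolding e[symmetric] using * c by (simp add: word_simps)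
    finally have kx: "k \<otimes> y \<otimes> inv k = x" .
    then have "(\<lambda>y. k \<otimes> y \<otimes> inv k) ` L \<inter> M \<noteq> {\<one>}" using * by blast
    then have eq: "(\<lambda>y. k \<otimes> y \<otimes> inv k) ` L = M"
      using triv_int[OF maximal_subgroup_conj_image[OF L(1) kc] M(1)] by blast
    then have zk: "k \<otimes> z \<otimes> inv k \<in> M" using L(2) by blast
    have zz: "z = inv k \<otimes> (k \<otimes> z \<otimes> inv k) \<otimes> k" using kc z by (simp add: word_simps)
    then have "k \<otimes> z \<otimes> inv k \<noteq> \<one>" using z(2) kc by (metis l_inv r_one inv_closed)
    then have "z \<in> conjugates_union M" using zz zk kc unfolding conjugates_union_def by blast
    then show False using z by simp
  qed
  then have "card (conjugates_union M) + card (conjugates_union L)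
      = card (conjugates_union M \<union> conjugates_union L)"
    using finite_subset[OF sub fin] M L by (simp add: card_Un_disjoint)
  also have "\<dots> \<le> card (carrier G - {\<one>})"
    using sub one_not M L fin by (intro card_mono) auto
  also have "\<dots> < order G" unfolding order_def using fin by (intro psubset_card_mono) auto
  finally show False using big(1)[OF M] big(1)[OF L(1) L1] by linarith
qed

end

section \<open>Minimal non-nilpotent sections\<close>

lemma funpow_mult_fixed:
  assumes "(f ^^ q) x = x"
  shows "(f ^^ (k * q)) x = x"
  using assms by (induction k) (simp_all add: funpow_add)

text \<open>By Bezout some multiple of \<open>d\<close> exceeds a multiple of \<open>q\<close> by 1.
  Both iterates fix \<open>x\<close>, hence so does \<open>f\<close>.\<close>

lemma funpow_prime_fixed:
  assumes "prime (q::nat)" "(f ^^ q) x = x" "(f ^^ d) x = x" "\<not> q dvd d"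
  shows "f x = x"
proof -
  have "coprime d q" using prime_imp_coprime[OF assms(1,4)] coprime_commute by blast
  moreover have "d \<noteq> 0" using assms(4) by (intro notI) simp
  ultimately obtain a b where ab: "d * a = q * b + 1"
    using bezout_nat[of d q] by (auto simp: coprime_iff_gcd_eq_1)
  have "(f ^^ (a * d)) x = x" by (rule funpow_mult_fixed[OF assms(3)])
  then have "(f ^^ (1 + b * q)) x = x" using ab by (simp add: mult.commute)
  then show ?thesis unfolding funpow_add using funpow_mult_fixed[OF assms(2)] by simp
qed

text \<open>Every orbit has exactly \<open>q\<close> elements; one orbit is removed and induction
  applies to the rest.\<close>

lemma prime_dvd_card_fixed_point_free:
  assumes "finite X" "prime (q::nat)" "f ` X \<subseteq> X"
    and "\<And>x. x \<in> X \<Longrightarrow> (f ^^ q) x = x" "\<And>x. x \<in> X \<Longrightarrow> f x \<noteq> x"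
  shows "q dvd card X"
  using assms(1,3-)
proof (induction X rule: finite_psubset_induct)
  case (psubset X)
  show ?case
  proof (cases "X = {}")
    case False
    then obtain x where x: "x \<in> X" by blast
    have q0: "q > 0" using assms(2) prime_gt_0_nat by blast
    have fi: "(f ^^ i) x \<in> X" for i using x psubset.prems(1) by (induction i) auto
    define O' where "O' = (\<lambda>i. (f ^^ i) x) ` {..<q}"
    have "inj_on (\<lambda>i. (f ^^ i) x) {..<q}"
    proof (rule linorder_inj_onI)
      fix i j assume ij: "i < j" "i \<in> {..<q}" "j \<in> {..<q}"
      show "(f ^^ i) x \<noteq> (f ^^ j) x"
      proof
        assume eq: "(f ^^ i) x = (f ^^ j) x"
        define z d where "z = (f ^^ i) x" and "d = j - i"
        have "(f ^^ d) z = (f ^^ (d + i)) x" by (simp add: z_def funpow_add)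
        also have "\<dots> = z" using ij eq by (simp add: z_def d_def)
        finally have "(f ^^ d) z = z" .
        moreover have "\<not> q dvd d" using ij by (auto simp: d_def dest: dvd_imp_le)
        ultimately have "f z = z"
          using funpow_prime_fixed[OF assms(2)] psubset.prems(2)[OF fi[of i]] by (simp add: z_def)
        then show False using psubset.prems(3)[OF fi[of i]] by (simp add: z_def)
      qed
    qed auto
    then have cO: "card O' = q" by (simp add: O'_def card_image)
    have OX: "O' \<subseteq> X" using fi by (auto simp: O'_def)
    \<comment> \<open>The orbit also contains the preimages of its elements, since
      \<open>f ^^ (q - 1)\<close> undoes \<open>f\<close>; hence \<open>f\<close> maps the
      complement to itself.\<close>
    have fO: "z \<in> O'" if z: "z \<in> X" "f z \<in> O'" for z
    proof -
      obtain i where i: "f z = (f ^^ i) x" using z by (auto simp: O'_def)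
      have "z = (f ^^ (q - 1)) (f z)"
        using psubset.prems(2)[OF z(1)] q0 by (metis Suc_diff_1 comp_apply funpow_Suc_right)
      also have "\<dots> = (f ^^ (q - 1 + i)) x" using i by (simp add: funpow_add)
      also have "\<dots> = (f ^^ ((q - 1 + i) mod q)) x"
        by (rule funpow_mod_eq[OF psubset.prems(2)[OF x], symmetric])
      finally show ?thesis using q0 by (auto simp: O'_def)
    qed
    have "q dvd card (X - O')"
    proof (rule psubset.IH)
      have "x \<in> O'" using q0 by (auto simp: O'_def intro!: image_eqI[of _ _ 0])
      then show "X - O' \<subset> X" using x by blast
      show "f ` (X - O') \<subseteq> X - O'" using psubset.prems(1) fO by blast
    qed (use psubset.prems in auto)
    moreover have "card X = card (X - O') + q"
      using cO OX psubset.hyps by (metis card_Diff_subset card_mono finite_subset le_add_diff_inverse2)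
    ultimately show ?thesis by simp
  qed simp
qed

context group
begin

text \<open>The hypotheses describe a non-nilpotent group all of whose proper sections are nilpotent.\<close>

lemma exists_fixed_point_free_operator:
  assumes fin: "finite (carrier G)"
    and nonnil: "\<not> nilpotent_subset G (carrier G)"
    and nil: "\<And>H. subgroup H G \<Longrightarrow> H \<noteq> carrier G \<Longrightarrow> nilpotent_subset G H"
    and quot: "\<And>N. N \<lhd> G \<Longrightarrow> N \<noteq> {\<one>} \<Longrightarrow> \<exists>c. relative_lcs G (carrier G) c \<subseteq> N"
  obtains R y and q :: nat where "R \<lhd> G" "R \<noteq> {\<one>}" "\<forall>a\<in>R. \<forall>b\<in>R. a \<otimes> b = b \<otimes> a"
    "y \<in> carrier G" "prime q" "\<forall>r\<in>R. y [^] q \<otimes> r = r \<otimes> y [^] q"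
    "\<forall>r\<in>R. y \<otimes> r = r \<otimes> y \<longrightarrow> r = \<one>"
proof -
  define \<gamma> where "\<gamma> = relative_lcs G (carrier G)"
  have g0: "\<gamma> 0 = carrier G" and gS: "\<gamma> (Suc i) = commutator_subgroup G (\<gamma> i) (carrier G)" for i
    by (simp_all add: \<gamma>_def)
  have gn: "\<gamma> i \<lhd> G" for i unfolding \<gamma>_def by (rule normal_relative_lcs)
  have gs: "subgroup (\<gamma> i) G" for i unfolding \<gamma>_def by (rule subgroup_relative_lcs[OF subgroup_self])
  have gne: "\<not> \<gamma> i \<subseteq> {\<one>}" for i
    using nonnil subgroup.one_closed[OF gs[of i]] unfolding nilpotent_subset_def \<gamma>_def by blast
  have gdec: "\<gamma> j \<subseteq> \<gamma> i" if "i \<le> j" for i j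
    unfolding \<gamma>_def by (rule relative_lcs_antimono[OF subgroup_self that])
  have central: "False" if "\<gamma> i \<subseteq> centralizing (carrier G)" for i
  proof -
    have "\<gamma> (Suc i) \<subseteq> {\<one>}" unfolding gS
    proof (rule commutator_subgroup_minimal[OF triv_subgroup])
      fix h k assume "h \<in> \<gamma> i" "k \<in> carrier G"
      then have "h \<in> carrier G" "h \<otimes> k = k \<otimes> h" using that by (auto simp: centralizing_def)
      then show "h \<otimes> k \<otimes> inv h \<otimes> inv k \<in> {\<one>}"
        using commutator_eq_one_iff[of h k] \<open>k \<in> carrier G\<close> by simp
    qed
    then show False using gne by blast
  qed
  have noncomm: "\<not> comm_group G"
  proof
    assume "comm_group G"
    then interpret comm_group G .
    show False using central[of 0] m_comm by (auto simp: g0 centralizing_def)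
  qed
  \<comment> \<open>The quotient by a nontrivial centre would be nilpotent, which makes some
    \<open>\<gamma> c\<close> central and the next term trivial.\<close>
  have Z: "centralizing (carrier G) = {\<one>}"
  proof (rule ccontr)
    assume "centralizing (carrier G) \<noteq> {\<one>}"
    moreover have "centralizing (carrier G) \<lhd> G"
      using subgroup_centralizing[of "carrier G"] centralizing_conj_closed[OF normal_self]
      by (auto simp: normal_inv_iff)
    ultimately obtain c where "\<gamma> c \<subseteq> centralizing (carrier G)" using quot unfolding \<gamma>_def by blast
    then show False using central by blast
  qed
  \<comment> \<open>The series is stationary from a term of least size on. This term
    \<open>R\<close> lies in every nontrivial normal subgroup, because the quotient by such a
    subgroup is nilpotent.\<close>
  obtain c where c: "\<And>i. card (\<gamma> c) \<le> card (\<gamma> i)"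
    using ex_has_least_nat[of "\<lambda>_. True" 0 "\<lambda>i. card (\<gamma> i)"] by blast
  define R where "R = \<gamma> c"
  have Rg: "R \<subseteq> \<gamma> i" for i
  proof (cases "c \<le> i")
    case True
    have "finite (\<gamma> c)" using subgroup.subset[OF gs] fin finite_subset by blast
    then have "\<gamma> i = \<gamma> c" using gdec[OF True] c[of i] by (simp add: card_subset_eq card_mono le_antisym)
    then show ?thesis by (simp add: R_def)
  qed (use gdec in \<open>simp add: R_def\<close>)
  have Rmin: "R \<subseteq> N" if "N \<lhd> G" "N \<noteq> {\<one>}" for N
    using quot[OF that] Rg unfolding \<gamma>_def by blast
  have Rn: "R \<lhd> G" and Rs: "subgroup R G" and R1: "R \<noteq> {\<one>}"
    unfolding R_def using gn gs gne by auto
  \<comment> \<open>\<open>N\<close> comes from Schmidt's theorem. Being nilpotent, it has a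
    nontrivial centre, which is normal in \<open>G\<close> and so contains \<open>R\<close>; thus
    \<open>R\<close> is abelian.\<close>
  obtain N where N: "N \<lhd> G" "N \<noteq> {\<one>}" "N \<noteq> carrier G"
    using exists_normal_if_proper_subgroups_nilpotent[OF fin nil noncomm] by blast
  have Ns: "subgroup N G" and Nc: "\<And>g x. g \<in> carrier G \<Longrightarrow> x \<in> N \<Longrightarrow> g \<otimes> x \<otimes> inv g \<in> N"
    using N(1) by (auto simp: normal_inv_iff)
  have "N \<inter> centralizing N \<noteq> {\<one>}"
    by (rule nilpotent_normal_meets_center[OF Ns nil[OF Ns N(3)] Ns N(2) order_refl])
      (use Nc subgroup.mem_carrier[OF Ns] in blast)
  moreover have "N \<inter> centralizing N \<lhd> G"
    unfolding normal_inv_iff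
    using subgroups_Inter_pair[OF Ns subgroup_centralizing[OF subgroup.subset[OF Ns]]] Nc
      centralizing_conj_closed[OF N(1)] by blast
  ultimately have RN: "R \<subseteq> N \<inter> centralizing N" by (rule Rmin[rotated])
  have Rab: "a \<otimes> b = b \<otimes> a" if "a \<in> R" "b \<in> R" for a b
    using RN that unfolding centralizing_def by blast
  have g1: "\<gamma> 1 \<noteq> carrier G"
  proof
    assume 1: "\<gamma> 1 = carrier G"
    have "\<gamma> i = carrier G" for i
      by (induction i) (use 1 gS[of 0] gS g0 in auto)
    then have "R = carrier G" by (simp add: R_def)
    then have "comm_group G" using Rab by (intro group_comm_groupI) simp
    then show False using noncomm by simp
  qed
  \<comment> \<open>A maximal subgroup above the commutator subgroup \<open>\<gamma> 1\<close> is
    normal: the commutators absorb the effect of conjugation.\<close>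
  obtain L where L: "maximal_subgroup L" "\<gamma> 1 \<subseteq> L"
    using exists_maximal_subgroup_above[OF fin gs g1] by blast
  have Ls: "subgroup L G" "L \<noteq> carrier G"
    and Lmax: "\<And>H. subgroup H G \<Longrightarrow> L \<subseteq> H \<Longrightarrow> H = L \<or> H = carrier G"
    using L(1) unfolding maximal_subgroup_def by blast+
  have Lmem: "x \<in> carrier G" if "x \<in> L" for x by (rule subgroup.mem_carrier[OF Ls(1) that])
  have Lc: "g \<otimes> x \<otimes> inv g \<in> L" if "g \<in> carrier G" "x \<in> L" for g x
  proof -
    have "g \<otimes> x \<otimes> inv g \<otimes> inv x \<in> \<gamma> 1"
      unfolding One_nat_def gS g0 by (rule commutator_in_commutator_subgroup) (use that Lmem in auto)
    then have "(g \<otimes> x \<otimes> inv g \<otimes> inv x) \<otimes> x \<in> L"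
      using L(2) that(2) subgroup.m_closed[OF Ls(1)] by blast
    then show ?thesis using that Lmem by (simp add: word_simps)
  qed
  have Ln: "L \<lhd> G" using Ls Lc by (auto simp: normal_inv_iff)
  have "L \<noteq> {\<one>}" using L(2) gne by blast
  then have RL: "R \<subseteq> L" using Rmin[OF Ln] by blast
  have Rconj: "g \<otimes> x \<otimes> inv g \<in> R" if "g \<in> carrier G" "x \<in> R" for g x
    using Rn that by (auto simp: normal_inv_iff)
  \<comment> \<open>Since \<open>L\<close> is nilpotent, its centralizer meets \<open>R\<close>
    nontrivially; by \<open>Rmin\<close> the whole of \<open>R\<close> is centralized by
    \<open>L\<close>.\<close>
  have "R \<inter> centralizing L \<noteq> {\<one>}"
    by (rule nilpotent_normal_meets_center[OF Ls(1) nil[OF Ls] Rs R1 RL]) (use Rconj Lmem in blast)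
  moreover have "R \<inter> centralizing L \<lhd> G"
    unfolding normal_inv_iff
    using subgroups_Inter_pair[OF Rs subgroup_centralizing[OF subgroup.subset[OF Ls(1)]]] Rconj
      centralizing_conj_closed[OF Ln] by blast
  ultimately have RZ: "R \<subseteq> R \<inter> centralizing L" by (rule Rmin[rotated])
  obtain z where z: "z \<in> carrier G" "z \<notin> L" using Ls subgroup.subset by blast
  \<comment> \<open>\<open>t\<close> is the order of \<open>z\<close> modulo \<open>L\<close>.
    Dividing it by a prime factor \<open>q\<close> gives a power \<open>y\<close> of
    \<open>z\<close> outside \<open>L\<close> whose \<open>q\<close>-th power lies in
    \<open>L\<close> and so centralizes \<open>R\<close>.\<close>
  define t where "t = (LEAST t::nat. 0 < t \<and> z [^] t \<in> L)"
  have "0 < order G \<and> z [^] order G \<in> L"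
    using pow_order_eq_1[OF z(1)] subgroup.one_closed[OF Ls(1)] fin order_gt_0_iff_finite by simp
  then have t: "0 < t" "z [^] t \<in> L"
    using LeastI[of "\<lambda>t. 0 < t \<and> z [^] t \<in> L" "order G"] unfolding t_def by blast+
  have tmin: "z [^] s \<notin> L" if "0 < s" "s < t" for s :: nat
    using not_less_Least[of s "\<lambda>t. 0 < t \<and> z [^] t \<in> L"] that unfolding t_def by blast
  have "t \<noteq> 1" using t z by auto
  then obtain q where q: "prime q" "q dvd t" using prime_factor_nat by blast
  then obtain s where s: "t = s * q" by (metis dvd_def mult.commute)
  have s0: "0 < s" "s < t" using s t q prime_gt_1_nat[of q] by (auto intro: Nat.gr0I)
  define y where "y = z [^] s"
  have y: "y \<in> carrier G" "y \<notin> L" using z tmin[OF s0] by (auto simp: y_def)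
  have yq: "y [^] q \<in> L" unfolding y_def using t(2) s z by (simp add: nat_pow_pow)
  show ?thesis
  proof (rule that[OF Rn R1 _ y(1) q(1)]; intro ballI impI)
    fix a b assume "a \<in> R" "b \<in> R"
    then show "a \<otimes> b = b \<otimes> a" by (rule Rab)
  next
    fix r assume r: "r \<in> R"
    show "y [^] q \<otimes> r = r \<otimes> y [^] q" using RZ r yq by (auto simp: centralizing_def)
  next
    fix r assume r: "r \<in> R" and yr: "y \<otimes> r = r \<otimes> y"
    have rc: "r \<in> carrier G" using r RL Lmem by blast
    \<comment> \<open>The centralizer of \<open>r\<close> contains the maximal subgroup
      \<open>L\<close> and also \<open>y\<close>, which lies outside \<open>L\<close>. So
      \<open>r\<close> is central, and \<open>Z\<close> applies.\<close>
    have "L \<subseteq> centralizing {r}"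
    proof
      fix x assume x: "x \<in> L"
      then have "r \<otimes> x = x \<otimes> r" using RZ r unfolding centralizing_def by blast
      then show "x \<in> centralizing {r}" using Lmem[OF x] by (simp add: centralizing_def)
    qed
    moreover have "y \<in> centralizing {r}" using y yr by (simp add: centralizing_def)
    moreover have "subgroup (centralizing {r}) G" using rc by (intro subgroup_centralizing) simp
    ultimately have "centralizing {r} = carrier G" using Lmax y by blast
    then have "x \<in> centralizing {r}" if "x \<in> carrier G" for x using that by simp
    then have "r \<in> centralizing (carrier G)" using rc by (auto simp: centralizing_def)
    then show "r = \<one>" using Z by simp
  qed
qed

end

section \<open>Passage to subgroups and quotients\<close>

lemma (in group_hom) relative_lcs_image:
  assumes "subgroup K G"
  shows "relative_lcs H (h ` K) i = h ` relative_lcs G K i"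
proof (induction i)
  case (Suc i)
  let ?c = "\<lambda>G A. \<Union>x \<in> A. \<Union>k \<in> K. {x \<otimes>\<^bsub>G\<^esub> k \<otimes>\<^bsub>G\<^esub> inv\<^bsub>G\<^esub> x \<otimes>\<^bsub>G\<^esub> inv\<^bsub>G\<^esub> k}"
  have mem: "x \<in> carrier G" if "x \<in> relative_lcs G K i" for x
    using that G.relative_lcs_Suc_subset[OF assms] by blast
  have memK: "x \<in> carrier G" if "x \<in> K" for x by (rule subgroup.mem_carrier[OF assms that])
  have "relative_lcs H (h ` K) (Suc i) = generate H (h ` ?c G (relative_lcs G K i))"
    unfolding relative_lcs.simps commutator_subgroup_def Suc
    by (rule arg_cong[of _ _ "generate H"]) (auto simp: image_UN mem memK)
  also have "\<dots> = h ` generate G (?c G (relative_lcs G K i))"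
    by (rule generate_img) (auto simp: mem memK)
  finally show ?case by (simp add: commutator_subgroup_def)
qed simp

lemma (in group) nilpotent_subset_subgroup:
  assumes L: "subgroup L G" and K: "subgroup K (G\<lparr>carrier := L\<rparr>)"
  shows "nilpotent_subset (G\<lparr>carrier := L\<rparr>) K \<longleftrightarrow> nilpotent_subset G K"
proof -
  interpret i: group_hom "G\<lparr>carrier := L\<rparr>" G id
    using subgroup_imp_group[OF L] is_group subgroup.subset[OF L]
    by (auto simp: group_hom_def group_hom_axioms_def hom_def)
  show ?thesis using i.relative_lcs_image[OF K] by (simp add: nilpotent_subset_def)
qed

text \<open>The last clause says that quotients by nontrivial normal subgroups are nilpotent,
  without forming them.\<close>

definition minimal_nonnilpotent :: "('a, 'm) monoid_scheme \<Rightarrow> bool" where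
  "minimal_nonnilpotent K \<longleftrightarrow> group K \<and> finite (carrier K) \<and> \<not> nilpotent_subset K (carrier K) \<and>
     (\<forall>H. subgroup H K \<longrightarrow> H \<noteq> carrier K \<longrightarrow> nilpotent_subset K H) \<and>
     (\<forall>N. N \<lhd> K \<longrightarrow> N \<noteq> {\<one>\<^bsub>K\<^esub>} \<longrightarrow> (\<exists>c. relative_lcs K (carrier K) c \<subseteq> N))"

text \<open>\<open>L\<close> is a smallest non-nilpotent subgroup, and \<open>N\<close> a largest
  normal subgroup of \<open>L\<close> with non-nilpotent quotient. Subgroups of the quotient are
  handled through their preimages in \<open>L\<close>.\<close>

lemma (in group) exists_minimal_nonnilpotent_section:
  assumes fin: "finite (carrier G)" and nonnil: "\<not> nilpotent_group G"
  obtains L N where "subgroup L G" "N \<lhd> G\<lparr>carrier := L\<rparr>"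
    "minimal_nonnilpotent (G\<lparr>carrier := L\<rparr> Mod N)"
proof -
  have "\<not> nilpotent_subset G (carrier G)"
    using nonnil is_group by (simp add: nilpotent_subset_def nilpotent_group_def relative_lcs_carrier)
  then obtain L where L: "subgroup L G" "\<not> nilpotent_subset G L"
    and Lmin: "\<And>K. subgroup K G \<Longrightarrow> \<not> nilpotent_subset G K \<Longrightarrow> card L \<le> card K"
    using ex_has_least_nat[of "\<lambda>L. subgroup L G \<and> \<not> nilpotent_subset G L" "carrier G" card]
      subgroup_self by blast
  define G' where "G' = G\<lparr>carrier := L\<rparr>"
  interpret G': group G' unfolding G'_def by (rule subgroup_imp_group[OF L(1)])
  have cG': "carrier G' = L" and oG': "\<one>\<^bsub>G'\<^esub> = \<one>" by (simp_all add: G'_def)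
  have finL: "finite L" using subgroup.subset[OF L(1)] fin finite_subset by blast
  have nonnil': "\<not> nilpotent_subset G' L"
    using nilpotent_subset_subgroup[OF L(1), of L] L G'.subgroup_self by (simp add: G'_def)
  have nil': "nilpotent_subset G' K" if K: "subgroup K G'" "K \<noteq> L" for K
  proof (rule ccontr)
    assume "\<not> nilpotent_subset G' K"
    then have "\<not> nilpotent_subset G K"
      using nilpotent_subset_subgroup[OF L(1), of K] K by (simp add: G'_def)
    moreover have "subgroup K G" using incl_subgroup[OF L(1)] K by (simp add: G'_def)
    ultimately have "card L \<le> card K" using Lmin by blast
    moreover have "K \<subset> L" using subgroup.subset[OF K(1)] K(2) cG' by blast
    then have "card K < card L" by (rule psubset_card_mono[OF finL])
    ultimately show False by linarith
  qed
  let ?Q = "\<lambda>N. N \<lhd> G' \<and> (\<forall>c. \<not> relative_lcs G' L c \<subseteq> N)"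
  have sL: "subgroup L G'" using G'.subgroup_self cG' by simp
  have "?Q {\<one>\<^bsub>G'\<^esub>}"
    using nonnil' G'.one_is_normal subgroup.one_closed[OF G'.subgroup_relative_lcs[OF sL]]
    unfolding nilpotent_subset_def by blast
  moreover have "\<forall>N. ?Q N \<longrightarrow> card N < Suc (card L)"
    using card_mono[OF finL] subgroup.subset[OF normal_imp_subgroup] cG' by (metis less_Suc_eq_le)
  ultimately obtain N where N: "N \<lhd> G'" "\<And>c. \<not> relative_lcs G' L c \<subseteq> N"
    and Nmax: "\<And>M. ?Q M \<Longrightarrow> card M \<le> card N"
    using ex_has_greatest_nat[of ?Q "{\<one>\<^bsub>G'\<^esub>}" card "Suc (card L)"] by blast
  interpret N: normal N G' by (rule N(1))
  define K where "K = G' Mod N"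
  define p where "p x = N #>\<^bsub>G'\<^esub> x" for x
  interpret p: group_hom G' K p
    unfolding K_def p_def[abs_def] group_hom_def group_hom_axioms_def
    using N.factorgroup_is_group N.r_coset_hom_Mod G'.is_group by blast
  have cK: "carrier K = p ` L" unfolding K_def p_def[abs_def] carrier_FactGroup cG' ..
  have oK: "\<one>\<^bsub>K\<^esub> = N" by (simp add: K_def)
  have p1: "p x = N \<longleftrightarrow> x \<in> N" if "x \<in> L" for x
    unfolding p_def using that cG' N.subgroup_axioms
    by (metis G'.coset_join1 G'.coset_join2 N.subset)
  have lcsK: "relative_lcs K (p ` H) c = p ` relative_lcs G' H c" if "subgroup H G'" for H c
    by (rule p.relative_lcs_image[OF that])
  have pre: "subgroup {x \<in> L. p x \<in> H} G'" if "subgroup H K" for H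
  proof (rule G'.subgroupI)
    have "\<one>\<^bsub>G'\<^esub> \<in> {x \<in> L. p x \<in> H}"
      using subgroup.one_closed[OF that] G'.one_closed cG' p.hom_one by simp
    then show "{x \<in> L. p x \<in> H} \<noteq> {}" by blast
  qed (use cG' that G'.m_closed G'.inv_closed in
      \<open>auto simp: subgroup.m_closed subgroup.m_inv_closed\<close>)
  have preim: "p ` {x \<in> L. p x \<in> H} = H" if "H \<subseteq> carrier K" for H
    using that unfolding cK by blast
  have "minimal_nonnilpotent K" unfolding minimal_nonnilpotent_def
  proof (intro conjI allI impI)
    show "group K" by (rule p.H.is_group)
    show "finite (carrier K)" using finL cK by simp
    show "\<not> nilpotent_subset K (carrier K)"
    proof
      assume "nilpotent_subset K (carrier K)"
      then obtain c where "p ` relative_lcs G' L c = {N}"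
        unfolding nilpotent_subset_def cK lcsK[OF sL] oK by blast
      then have "p x = N" if "x \<in> relative_lcs G' L c" for x using that by blast
      then have "relative_lcs G' L c \<subseteq> N" 
        using p1 G'.relative_lcs_subset[OF sL, of c] by (metis subsetD subsetI)
      then show False using N(2) by blast
    qed
  next
    fix H assume H: "subgroup H K" "H \<noteq> carrier K"
    define H' where "H' = {x \<in> L. p x \<in> H}"
    have H': "p ` H' = H" unfolding H'_def by (rule preim[OF subgroup.subset[OF H(1)]])
    then have "H' \<noteq> L" using H(2) cK by blast
    then obtain c where "relative_lcs G' H' c = {\<one>\<^bsub>G'\<^esub>}"
      using nil'[of H'] pre[OF H(1)] unfolding H'_def nilpotent_subset_def by blast
    then have "relative_lcs K H c = {\<one>\<^bsub>K\<^esub>}"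
      using lcsK[of H' c] pre[OF H(1)] H' unfolding H'_def by simp
    then show "nilpotent_subset K H" by (auto simp: nilpotent_subset_def)
  next
    fix M assume M: "M \<lhd> K" "M \<noteq> {\<one>\<^bsub>K\<^esub>}"
    then have Ms: "subgroup M K" by (rule_tac normal_imp_subgroup)
    define M' where "M' = {x \<in> L. p x \<in> M}"
    have M'M: "p ` M' = M" unfolding M'_def by (rule preim[OF subgroup.subset[OF Ms]])
    have M's: "subgroup M' G'" unfolding M'_def by (rule pre[OF Ms])
    have "x \<otimes>\<^bsub>G'\<^esub> h \<otimes>\<^bsub>G'\<^esub> inv\<^bsub>G'\<^esub> x \<in> M'" if "x \<in> carrier G'" "h \<in> M'" for x h
    proof -
      have "p x \<otimes>\<^bsub>K\<^esub> p h \<otimes>\<^bsub>K\<^esub> inv\<^bsub>K\<^esub> p x \<in> M"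
        using M(1) that cG' unfolding p.H.normal_inv_iff M'_def by auto
      moreover have hc: "h \<in> carrier G'" using that cG' unfolding M'_def by simp
      ultimately have "p (x \<otimes>\<^bsub>G'\<^esub> h \<otimes>\<^bsub>G'\<^esub> inv\<^bsub>G'\<^esub> x) \<in> M" using that(1) by simp
      moreover have "x \<otimes>\<^bsub>G'\<^esub> h \<otimes>\<^bsub>G'\<^esub> inv\<^bsub>G'\<^esub> x \<in> carrier G'" using that(1) hc by simp
      ultimately show ?thesis unfolding M'_def cG' by blast
    qed
    then have M'n: "M' \<lhd> G'" using M's by (simp add: G'.normal_inv_iff)
    have NM: "N \<subseteq> M'"
      using p1 N.subset cG' subgroup.one_closed[OF Ms] unfolding M'_def oK by auto
    have "M' \<noteq> N"
    proof
      assume "M' = N"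
      then have "M = p ` N" using M'M by simp
      also have "\<dots> \<subseteq> {N}" using p1 N.subset cG' by auto
      finally have "M \<subseteq> {N}" .
      then show False using M(2) subgroup.one_closed[OF Ms] oK by blast
    qed
    then have "card N < card M'"
      using NM finL by (intro psubset_card_mono) (auto simp: M'_def)
    then have "\<not> ?Q M'" using Nmax[of M'] leD by blast
    then obtain c where "relative_lcs G' L c \<subseteq> M'" using M'n by blast
    then have "relative_lcs K (carrier K) c \<subseteq> M" unfolding cK lcsK[OF sL] using M'M by blast
    then show "\<exists>c. relative_lcs K (carrier K) c \<subseteq> M" ..
  qed
  then show ?thesis using that L(1) N(1) unfolding K_def G'_def by blast
qed

section \<open>Laws of non-nilpotent groups\<close>

text \<open>Words in the letters \<open>x\<close>, encoded as \<^term>\<open>0::nat\<close>, and \<open>e\<^sub>i\<close>, encoded as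
  \<^term>\<open>Suc i\<close>.\<close>

fun exponent_sum :: "(nat \<Rightarrow> nat) \<Rightarrow> nat list \<Rightarrow> nat" where
  "exponent_sum j [] = 0"
| "exponent_sum j (0 # w) = exponent_sum j w"
| "exponent_sum j (Suc i # w) = j i + exponent_sum j w"

text \<open>The number of occurrences of \<open>x\<close> that are applied at position \<open>0\<close> modulo \<open>q\<close>, when the
  word acts on \<open>\<int>\<^sup>m\<close> by \<open>e\<^sub>i\<close> being the \<open>i\<close>-th unit translation, starting at \<open>v\<close>.\<close>

fun hits :: "nat \<Rightarrow> nat \<Rightarrow> (nat \<Rightarrow> nat) \<Rightarrow> nat list \<Rightarrow> nat" where
  "hits q m v [] = 0"
| "hits q m v (0 # w) = (if \<forall>i<m. q dvd v i + count_list w (Suc i) then 1 else 0) + hits q m v w"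
| "hits q m v (Suc i # w) = hits q m v w"

lemma exponent_sum_eq:
  assumes "set w \<subseteq> {..m}"
  shows "exponent_sum j w = (\<Sum>i<m. j i * count_list w (Suc i))"
  using assms
proof (induction j w rule: exponent_sum.induct)
  case (3 j i w)
  then have i: "i < m" by simp
  have "(\<Sum>k<m. j k * count_list (Suc i # w) (Suc k))
      = (\<Sum>k<m. (if k = i then j k else 0) + j k * count_list w (Suc k))"
    by (rule sum.cong) auto
  also have "\<dots> = j i + (\<Sum>k<m. j k * count_list w (Suc k))"
    using i by (simp add: sum.distrib)
  finally show ?case using 3 by simp
qed simp_all

text \<open>Abstracts from the section found above: \<open>M\<close> stands for the abelian normal
  subgroup \<open>R\<close>, and \<open>\<theta>\<close> for conjugation by
  \<open>y\<close>.\<close>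

locale fixed_point_free_operator = comm_group M for M (structure) +
  fixes \<theta> :: "'a \<Rightarrow> 'a" and q :: nat
  assumes fin: "finite (carrier M)" and hom: "\<theta> \<in> hom M M" and prime: "prime q"
    and period: "x \<in> carrier M \<Longrightarrow> (\<theta> ^^ q) x = x"
    and fixed: "x \<in> carrier M \<Longrightarrow> \<theta> x = x \<Longrightarrow> x = \<one>"
begin

lemma funpow_hom: "\<theta> ^^ k \<in> hom M M"
proof (induction k)
  case (Suc k)
  then show ?case using hom by (auto simp: hom_def Pi_def)
qed (simp add: hom_def)

lemma funpow_closed [simp]: "x \<in> carrier M \<Longrightarrow> (\<theta> ^^ k) x \<in> carrier M"
  using funpow_hom[of k] by (auto simp: hom_def)

lemma funpow_mult: "x \<in> carrier M \<Longrightarrow> y \<in> carrier M \<Longrightarrow> (\<theta> ^^ k) (x \<otimes> y) = (\<theta> ^^ k) x \<otimes> (\<theta> ^^ k) y"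
  using funpow_hom[of k] by (auto simp: hom_def)

lemma funpow_one [simp]: "(\<theta> ^^ k) \<one> = \<one>"
  by (rule hom_one[OF funpow_hom is_group is_group])

lemma funpow_dvd: "x \<in> carrier M \<Longrightarrow> q dvd k \<Longrightarrow> (\<theta> ^^ k) x = x"
  using funpow_mult_fixed[OF period] by (metis dvd_def mult.commute)

lemma funpow_mod: "x \<in> carrier M \<Longrightarrow> (\<theta> ^^ (k mod q)) x = (\<theta> ^^ k) x"
  using funpow_mod_eq[OF period] .

lemma funpow_fixed: "x \<in> carrier M \<Longrightarrow> \<not> q dvd k \<Longrightarrow> (\<theta> ^^ k) x = x \<Longrightarrow> x = \<one>"
  using funpow_prime_fixed[OF prime period] fixed by blast

lemma funpow_finprod:
  assumes "f \<in> A \<rightarrow> carrier M"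
  shows "(\<theta> ^^ k) (finprod M f A) = finprod M (\<lambda>a. (\<theta> ^^ k) (f a)) A"
  using assms
proof (induction A rule: infinite_finite_induct)
  case (insert a A)
  then show ?case by (simp add: funpow_mult Pi_def finprod_insert)
qed simp_all

text \<open>The nontrivial elements fall into orbits of length \<open>q\<close> under
  \<open>\<theta>\<close>, so the order of \<open>M\<close> is 1 modulo \<open>q\<close>.\<close>

lemma coprime_ord: "x \<in> carrier M \<Longrightarrow> coprime (ord x) q"
proof -
  assume x: "x \<in> carrier M"
  have "q dvd card (carrier M - {\<one>})"
  proof (rule prime_dvd_card_fixed_point_free[of _ _ \<theta>])
    show "\<theta> ` (carrier M - {\<one>}) \<subseteq> carrier M - {\<one>}"
    proof (intro image_subsetI)
      fix z assume z: "z \<in> carrier M - {\<one>}"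
      have "\<theta> z \<noteq> \<one>"
      proof
        assume "\<theta> z = \<one>"
        then have "(\<theta> ^^ (q - 1)) (\<theta> z) = \<one>" by simp
        then have "(\<theta> ^^ q) z = \<one>"
          using prime_gt_0_nat[OF prime] by (metis Suc_diff_1 comp_apply funpow_Suc_right)
        then show False using period z by simp
      qed
      then show "\<theta> z \<in> carrier M - {\<one>}" using z funpow_closed[of z 1] by simp
    qed
  qed (use fin prime period fixed in auto)
  moreover have "order M = Suc (card (carrier M - {\<one>}))"
    unfolding order_def using fin by (metis card_Suc_Diff1 one_closed)
  ultimately have "\<not> q dvd order M"
    using prime by (metis dvd_add_right_iff not_prime_unit plus_1_eq_Suc add.commute)
  then have "\<not> q dvd ord x" using ord_dvd_group_order[OF x] dvd_trans by blast
  then show ?thesis using prime_imp_coprime[OF prime] coprime_commute by blast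
qed

text \<open>Orthogonality of characters: the product is fixed by a power of \<open>\<theta>\<close>, unless all
  \<open>T i\<close> vanish modulo \<open>q\<close>.\<close>

lemma finprod_orthogonality:
  assumes x: "x \<in> carrier M"
  shows "finprod M (\<lambda>j. (\<theta> ^^ (\<Sum>i<m. j i * T i)) x) (PiE {..<m} (\<lambda>_. {..<q}))
    = (if \<forall>i<m. q dvd T i then x [^] (q ^ m) else \<one>)"
proof (cases "\<forall>i<m. q dvd T i")
  case True
  then have "(\<theta> ^^ (\<Sum>i<m. j i * T i)) x = x" for j
    using x by (intro funpow_dvd dvd_sum) auto
  then have "finprod M (\<lambda>j. (\<theta> ^^ (\<Sum>i<m. j i * T i)) x) (PiE {..<m} (\<lambda>_. {..<q}))
    = finprod M (\<lambda>j. x) (PiE {..<m} (\<lambda>_. {..<q}))" by simp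
  also have "\<dots> = x [^] card (PiE {..<m} (\<lambda>_. {..<q}))" by (rule finprod_const[OF x])
  finally show ?thesis using True by (simp add: card_PiE)
next
  case False
  then obtain k where k: "k < m" "\<not> q dvd T k" by blast
  have q0: "0 < q" by (rule prime_gt_0_nat[OF prime])
  define J where "J = PiE {..<m} (\<lambda>_. {..<q})"
  define f where "f j = (\<theta> ^^ (\<Sum>i<m. j i * T i)) x" for j :: "nat \<Rightarrow> nat"
  \<comment> \<open>\<open>s\<close> rotates a coordinate \<open>k\<close> at which
    \<open>T k\<close> is not divisible by \<open>q\<close>. It permutes the index set and applies
    \<open>\<theta> ^^ T k\<close> to each factor, so the product is fixed by this power of
    \<open>\<theta>\<close>.\<close>
  define s where "s j = j(k := (j k + 1) mod q)" for j :: "nat \<Rightarrow> nat"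
  have finJ: "finite J" unfolding J_def by (simp add: finite_PiE)
  have sJ: "s ` J \<subseteq> J"
  proof (intro image_subsetI)
    fix j assume "j \<in> J"
    then have "s j \<in> PiE (insert k {..<m}) (\<lambda>_. {..<q})"
      unfolding s_def J_def using q0 by (intro PiE_fun_upd) auto
    then show "s j \<in> J" using k by (simp add: J_def insert_absorb)
  qed
  have "inj_on s J"
  proof (rule inj_onI)
    fix a b assume ab: "a \<in> J" "b \<in> J" "s a = s b"
    have "a i = b i" for i
    proof (cases "i = k")
      case True
      have "(a k + 1) mod q = (b k + 1) mod q" using fun_cong[OF ab(3), of k] by (simp add: s_def)
      then have "a k mod q = b k mod q" by (metis cong_add_rcancel_nat cong_def)
      moreover have "a k < q" "b k < q" using ab k by (auto simp: J_def)
      ultimately show ?thesis using True by simp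
    next
      case False
      then show ?thesis using fun_cong[OF ab(3), of i] by (simp add: s_def)
    qed
    then show "a = b" by blast
  qed
  then have bij: "s ` J = J" using sJ finJ by (simp add: endo_inj_surj)
  have fs: "f (s j) = (\<theta> ^^ T k) (f j)" for j
  proof -
    have split: "(\<Sum>i<m. g i * T i) = g k * T k + (\<Sum>i \<in> {..<m} - {k}. g i * T i)" for g :: "nat \<Rightarrow> nat"
      using k by (simp add: sum.remove)
    have rest: "(\<Sum>i \<in> {..<m} - {k}. s j i * T i) = (\<Sum>i \<in> {..<m} - {k}. j i * T i)"
      by (rule sum.cong) (auto simp: s_def)
    have "[s j k * T k = (j k + 1) * T k] (mod q)"
      by (simp add: s_def cong_def mod_mult_left_eq)
    then have "[(\<Sum>i<m. s j i * T i) = T k + (\<Sum>i<m. j i * T i)] (mod q)"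
      unfolding split[of "s j"] split[of j] rest
      using cong_add_rcancel_nat[of "s j k * T k" "\<Sum>i \<in> {..<m} - {k}. j i * T i" "(j k + 1) * T k" q]
      by (simp add: add.assoc)
    then have "f (s j) = (\<theta> ^^ (T k + (\<Sum>i<m. j i * T i))) x"
      unfolding f_def cong_def using funpow_mod[OF x] by metis
    then show ?thesis by (simp add: f_def funpow_add)
  qed
  have fc: "f \<in> J \<rightarrow> carrier M" "f \<in> s ` J \<rightarrow> carrier M" using x by (auto simp: f_def)
  have "(\<theta> ^^ T k) (finprod M f J) = finprod M (\<lambda>j. f (s j)) J"
    unfolding fs by (rule funpow_finprod[OF fc(1)])
  also have "\<dots> = finprod M f (s ` J)" by (rule finprod_reindex[OF fc(2) \<open>inj_on s J\<close>, symmetric])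
  finally have "(\<theta> ^^ T k) (finprod M f J) = finprod M f J" by (simp add: bij)
  then have "finprod M f J = \<one>" using funpow_fixed[OF finprod_closed[OF fc(1)] k(2)] by blast
  then show ?thesis unfolding if_not_P[OF False] by (simp add: f_def[abs_def] J_def)
qed

text \<open>For \<open>\<theta>\<close> the conjugation by \<open>y\<close>, this is the component in \<open>M\<close> of the word with \<open>e\<^sub>i\<close> replaced
  by \<open>y\<close> to the power \<open>j i\<close>.\<close>

fun twisted_product :: "'a \<Rightarrow> (nat \<Rightarrow> nat) \<Rightarrow> nat list \<Rightarrow> 'a" where
  "twisted_product x j [] = \<one>"
| "twisted_product x j (0 # w) = (\<theta> ^^ exponent_sum j w) x \<otimes> twisted_product x j w"
| "twisted_product x j (Suc i # w) = twisted_product x j w"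

lemma twisted_product_closed [simp]: "x \<in> carrier M \<Longrightarrow> twisted_product x j w \<in> carrier M"
  by (induction x j w rule: twisted_product.induct) auto

text \<open>Each occurrence of \<open>x\<close> contributes a power of \<open>\<theta>\<close> whose
  exponent is linear in \<open>j\<close>, with the position at that moment as coefficients. By
  orthogonality it survives the product over all \<open>j\<close> exactly if it is a hit, and then
  as \<open>x [^] (q ^ m)\<close>.\<close>

lemma finprod_twisted_product:
  assumes x: "x \<in> carrier M" and "set w \<subseteq> {..m}"
  shows "finprod M (\<lambda>j. (\<theta> ^^ (\<Sum>i<m. j i * v i)) (twisted_product x j w)) (PiE {..<m} (\<lambda>_. {..<q}))
    = x [^] (q ^ m * hits q m v w)"
  using assms(2)
proof (induction w)
  case (Cons a w)
  show ?case
  proof (cases a)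
    case 0
    have "(\<theta> ^^ (\<Sum>i<m. j i * v i)) (twisted_product x j (a # w))
        = (\<theta> ^^ (\<Sum>i<m. j i * (v i + count_list w (Suc i)))) x
          \<otimes> (\<theta> ^^ (\<Sum>i<m. j i * v i)) (twisted_product x j w)" for j
    proof -
      have "exponent_sum j w = (\<Sum>i<m. j i * count_list w (Suc i))"
        using Cons.prems by (intro exponent_sum_eq) simp
      then show ?thesis
        using x 0 by (simp add: funpow_mult distrib_left sum.distrib funpow_add)
    qed
    then show ?thesis
      using x Cons finprod_orthogonality[OF x, where T = "\<lambda>i. v i + count_list w (Suc i)" and m = m] 0
      by (auto simp: finprod_multf Pi_def nat_pow_mult distrib_left)
  next
    case (Suc i)
    then show ?thesis using Cons by simp
  qed
qed (simp add: finprod_one_eqI)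

text \<open>The twisted products determine \<open>q ^ m * hits q m v w\<close> modulo the order of
  \<open>x\<close>, and \<open>q ^ m\<close> cancels by \<open>coprime_ord\<close>.\<close>

lemma hits_cong:
  assumes x: "x \<in> carrier M" and w: "set w \<subseteq> {..m}" "set w' \<subseteq> {..m}"
    and eq: "\<And>j. twisted_product x j w = twisted_product x j w'"
  shows "[hits q m v w = hits q m v w'] (mod ord x)"
proof -
  have "x [^] (q ^ m * hits q m v w) = x [^] (q ^ m * hits q m v w')"
    using finprod_twisted_product[OF x w(1)] finprod_twisted_product[OF x w(2)] eq by simp
  then have "[q ^ m * hits q m v w = q ^ m * hits q m v w'] (mod ord x)"
    using int_pow_eq[OF x, of "int (q ^ m * hits q m v w)" "int (q ^ m * hits q m v w')"]
    unfolding int_pow_int by (simp add: cong_iff_dvd_diff dvd_diff_commute flip: cong_int_iff)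
  moreover have "coprime (q ^ m) (ord x)" using coprime_ord[OF x] coprime_commute by auto
  ultimately show ?thesis by (simp add: cong_mult_lcancel_nat)
qed

end

context fixed_point_free_operator
begin

text \<open>As \<open>\<theta>\<close> is invertible, \<open>(\<theta> ^^ a) x\<close> is still
  nontrivial, and \<open>funpow_fixed\<close> applies to it with the difference of the
  exponents.\<close>

lemma funpow_eq_imp_cong:
  assumes x: "x \<in> carrier M" "x \<noteq> \<one>" and eq: "(\<theta> ^^ a) x = (\<theta> ^^ b) x"
  shows "[a = b] (mod q)"
proof -
  have *: "[a = b] (mod q)" if "a \<le> b" "(\<theta> ^^ a) x = (\<theta> ^^ b) x" for a b
  proof -
    define z where "z = (\<theta> ^^ a) x"
    have "(\<theta> ^^ (b - a)) z = (\<theta> ^^ (b - a + a)) x" by (simp add: z_def funpow_add)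
    then have fz: "(\<theta> ^^ (b - a)) z = z" using that by (simp add: z_def)
    have "z \<noteq> \<one>"
    proof
      assume "z = \<one>"
      then have "(\<theta> ^^ ((q - 1) * a)) z = \<one>" by simp
      then have "(\<theta> ^^ ((q - 1) * a + a)) x = \<one>" by (simp add: z_def funpow_add)
      moreover have "q dvd (q - 1) * a + a"
        using prime_gt_0_nat[OF prime] by (metis Suc_diff_1 add.commute dvd_triv_left mult_Suc)
      ultimately show False using funpow_dvd x by simp
    qed
    moreover have "z \<in> carrier M" using x by (simp add: z_def)
    ultimately have "q dvd b - a" using funpow_fixed fz by blast
    then show ?thesis using that(1) by (metis cong_altdef_nat cong_sym)
  qed
  show ?thesis
  proof (cases "a \<le> b")
    case False
    then have "[b = a] (mod q)" using * eq by simp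
    then show ?thesis by (rule cong_sym)
  qed (use * eq in blast)
qed

lemma twisted_product_one [simp]: "twisted_product \<one> j w = \<one>"
  by (induction "\<one>" j w rule: twisted_product.induct) auto

end

section \<open>Positive words and the laws of a group\<close>

fun word_product :: "('a, 'm) monoid_scheme \<Rightarrow> (nat \<Rightarrow> 'a) \<Rightarrow> nat list \<Rightarrow> 'a" where
  "word_product G g [] = \<one>\<^bsub>G\<^esub>"
| "word_product G g (a # w) = g a \<otimes>\<^bsub>G\<^esub> word_product G g w"

text \<open>Laws compare positive words, because terms of the algebra yield products without
  inverses.\<close>

definition group_law :: "('a, 'm) monoid_scheme \<Rightarrow> nat list \<Rightarrow> nat list \<Rightarrow> bool" where
  "group_law G w w' \<longleftrightarrow> (\<forall>g. range g \<subseteq> carrier G \<longrightarrow> word_product G g w = word_product G g w')"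

lemma word_product_map: "word_product G g (map l w) = word_product G (g \<circ> l) w"
  by (induction w) simp_all

text \<open>\<open>l\<close> may identify letters, as happens when several variables of an identity
  receive the same letter of the witness.\<close>

lemma group_law_map:
  assumes "group_law G w w'"
  shows "group_law G (map l w) (map l w')"
  unfolding group_law_def word_product_map
proof (intro allI impI)
  fix g :: "nat \<Rightarrow> 'a" assume "range g \<subseteq> carrier G"
  then have "range (g \<circ> l) \<subseteq> carrier G" by auto
  then show "word_product G (g \<circ> l) w = word_product G (g \<circ> l) w'"
    using assms unfolding group_law_def by blast
qed

lemma group_law_subgroup:
  assumes "group_law G w w'" "L \<subseteq> carrier G"
  shows "group_law (G\<lparr>carrier := L\<rparr>) w w'"
proof -
  have "word_product (G\<lparr>carrier := L\<rparr>) g w = word_product G g w" for g w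
    by (induction w) simp_all
  then show ?thesis using assms by (auto simp: group_law_def)
qed

lemma (in group) word_product_closed: "range g \<subseteq> carrier G \<Longrightarrow> word_product G g w \<in> carrier G"
  by (induction w) auto

lemma (in group_hom) group_law_image:
  assumes law: "group_law G w w'" and surj: "h ` carrier G = carrier H"
  shows "group_law H w w'"
  unfolding group_law_def
proof (intro allI impI)
  fix g :: "nat \<Rightarrow> 'c" assume g: "range g \<subseteq> carrier H"
  define f where "f = inv_into (carrier G) h \<circ> g"
  have f: "range f \<subseteq> carrier G" "h (f i) = g i" for i
    using g surj by (auto simp: f_def subset_iff intro!: inv_into_into f_inv_into_f)
  have "word_product H g u = h (word_product G f u)" for u
  proof (induction u)
    case (Cons a u)
    have "f a \<in> carrier G" using f by blast
    then show ?case using Cons G.word_product_closed[OF f(1)] f(2) by simp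
  qed simp
  moreover have "word_product G f w = word_product G f w'"
    using law f(1) unfolding group_law_def by blast
  ultimately show "word_product H g w = word_product H g w'" by simp
qed

text \<open>The law is tested in a minimal non-nilpotent section \<open>K\<close>, with letter 0
  sent into \<open>R\<close> and the letters \<open>Suc i\<close> to powers of \<open>y\<close>. The
  powers of \<open>y\<close>, through their action on \<open>R\<close>, give the first congruence,
  the components in \<open>R\<close> the second; \<open>n\<close> is the order of a nontrivial
  element of \<open>R\<close>.\<close>

lemma (in group) group_law_imp_hits_cong:
  assumes fin: "finite (carrier G)" and nonnil: "\<not> nilpotent_group G"
  obtains q n :: nat where "prime q" "n \<ge> 2"
    "\<And>w w' i. group_law G w w' \<Longrightarrow> [count_list w (Suc i) = count_list w' (Suc i)] (mod q)"
    "\<And>w w' m v. group_law G w w' \<Longrightarrow> set w \<subseteq> {..m} \<Longrightarrow> set w' \<subseteq> {..m} \<Longrightarrow>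
      [hits q m v w = hits q m v w'] (mod n)"
proof -
  obtain L N where L: "subgroup L G" and N: "N \<lhd> G\<lparr>carrier := L\<rparr>"
    and min: "minimal_nonnilpotent (G\<lparr>carrier := L\<rparr> Mod N)"
    using exists_minimal_nonnilpotent_section[OF fin nonnil] by blast
  define K where "K = G\<lparr>carrier := L\<rparr> Mod N"
  interpret N: normal N "G\<lparr>carrier := L\<rparr>" by (rule N)
  interpret p: group_hom "G\<lparr>carrier := L\<rparr>" K "\<lambda>x. N #>\<^bsub>G\<lparr>carrier := L\<rparr>\<^esub> x"
    unfolding K_def group_hom_def group_hom_axioms_def
    using N.factorgroup_is_group N.r_coset_hom_Mod subgroup_imp_group[OF L] by blast
  have lawK: "group_law K w w'" if "group_law G w w'" for w w'
    by (rule p.group_law_image[OF group_law_subgroup[OF that subgroup.subset[OF L]]])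
      (simp add: K_def carrier_FactGroup)
  have finK: "finite (carrier K)" using min by (simp add: minimal_nonnilpotent_def K_def)
  have K: "\<not> nilpotent_subset K (carrier K)"
    "\<And>H. subgroup H K \<Longrightarrow> H \<noteq> carrier K \<Longrightarrow> nilpotent_subset K H"
    "\<And>N. N \<lhd> K \<Longrightarrow> N \<noteq> {\<one>\<^bsub>K\<^esub>} \<Longrightarrow> \<exists>c. relative_lcs K (carrier K) c \<subseteq> N"
    using min unfolding minimal_nonnilpotent_def K_def[symmetric] by blast+
  obtain R y and q :: nat where R: "R \<lhd> K" "R \<noteq> {\<one>\<^bsub>K\<^esub>}"
    "\<forall>a\<in>R. \<forall>b\<in>R. a \<otimes>\<^bsub>K\<^esub> b = b \<otimes>\<^bsub>K\<^esub> a" and y: "y \<in> carrier K" and q: "prime q"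
    and yq: "\<forall>r\<in>R. y [^]\<^bsub>K\<^esub> q \<otimes>\<^bsub>K\<^esub> r = r \<otimes>\<^bsub>K\<^esub> y [^]\<^bsub>K\<^esub> q"
    and fpf: "\<forall>r\<in>R. y \<otimes>\<^bsub>K\<^esub> r = r \<otimes>\<^bsub>K\<^esub> y \<longrightarrow> r = \<one>\<^bsub>K\<^esub>"
    by (rule p.H.exists_fixed_point_free_operator[OF finK K])
  interpret R: normal R K by (rule R(1))
  note word = p.H.word_simps
  \<comment> \<open>With this direction of conjugation, \<open>x\<close> times
    \<open>y [^] k\<close> is \<open>y [^] k\<close> times \<open>(\<theta> ^^ k) x\<close>, so all
    powers of \<open>y\<close> collect on the left.\<close>
  define \<theta> where "\<theta> x = inv\<^bsub>K\<^esub> y \<otimes>\<^bsub>K\<^esub> x \<otimes>\<^bsub>K\<^esub> y" for x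
  define M where "M = K\<lparr>carrier := R\<rparr>"
  have M: "carrier M = R" "monoid.mult M = monoid.mult K" "one M = one K" by (simp_all add: M_def)
  have pow: "(\<theta> ^^ k) x = inv\<^bsub>K\<^esub> (y [^]\<^bsub>K\<^esub> k) \<otimes>\<^bsub>K\<^esub> x \<otimes>\<^bsub>K\<^esub> y [^]\<^bsub>K\<^esub> k" if "x \<in> R" for k x
    using that y by (induction k) (simp_all add: \<theta>_def word)
  have gM: "group M" unfolding M_def by (rule p.H.subgroup_imp_group[OF R.subgroup_axioms])
  have cM: "comm_group M" by (rule group.group_comm_groupI[OF gM]) (simp add: M R)
  have \<theta>R: "\<theta> x \<in> R" if "x \<in> R" for x
    unfolding \<theta>_def by (rule R.inv_op_closed1[OF y that])
  interpret M: fixed_point_free_operator M \<theta> q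
  proof (intro fixed_point_free_operator.intro fixed_point_free_operator_axioms.intro cM q)
    show "finite (carrier M)" using finK R.subset finite_subset M by metis
    show "\<theta> \<in> hom M M"
      by (rule homI) (use \<theta>R y in \<open>simp_all add: M \<theta>_def word\<close>)
    show "(\<theta> ^^ q) x = x" if "x \<in> carrier M" for x
    proof -
      have x: "x \<in> R" using that M by simp
      have "inv\<^bsub>K\<^esub> (y [^]\<^bsub>K\<^esub> q) \<otimes>\<^bsub>K\<^esub> x \<otimes>\<^bsub>K\<^esub> y [^]\<^bsub>K\<^esub> q
          = inv\<^bsub>K\<^esub> (y [^]\<^bsub>K\<^esub> q) \<otimes>\<^bsub>K\<^esub> (y [^]\<^bsub>K\<^esub> q \<otimes>\<^bsub>K\<^esub> x)"
        using bspec[OF yq x] x y by (simp add: p.H.m_assoc)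
      then show ?thesis using x y by (simp add: pow word)
    qed
    show "x = \<one>\<^bsub>M\<^esub>" if "x \<in> carrier M" "\<theta> x = x" for x
    proof -
      have x: "x \<in> R" using that M by simp
      have "y \<otimes>\<^bsub>K\<^esub> x = y \<otimes>\<^bsub>K\<^esub> \<theta> x" using that by simp
      also have "\<dots> = x \<otimes>\<^bsub>K\<^esub> y" unfolding \<theta>_def using x y by (simp add: word)
      finally show ?thesis using bspec[OF fpf x] M by simp
    qed
  qed
  define g where "g x j = case_nat x (\<lambda>i. y [^]\<^bsub>K\<^esub> (j i :: nat))" for x and j :: "nat \<Rightarrow> nat"
  have grange: "range (g x j) \<subseteq> carrier K" if "x \<in> R" for x j
    using that y by (auto simp: g_def split: nat.splits)
  have val: "word_product K (g x j) w = y [^]\<^bsub>K\<^esub> exponent_sum j w \<otimes>\<^bsub>K\<^esub> M.twisted_product x j w"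
    if x: "x \<in> R" for x j w
    using x
  proof (induction x j w rule: M.twisted_product.induct)
    case (2 x j w)
    have tc: "M.twisted_product x j w \<in> carrier K"
      using M.twisted_product_closed[of x j w] 2(2) R.subset M by auto
    have xc: "x \<in> carrier K" using 2(2) by simp
    show ?case using 2 y tc xc by (simp add: g_def pow M word)
  next
    case (3 x j i w)
    have tc: "M.twisted_product x j w \<in> carrier K"
      using M.twisted_product_closed[of x j w] 3(2) R.subset M by auto
    show ?case using 3 y tc by (simp add: g_def word p.H.nat_pow_mult[symmetric])
  qed (use M in simp)
  have tpeq: "y [^]\<^bsub>K\<^esub> exponent_sum j w = y [^]\<^bsub>K\<^esub> exponent_sum j w' \<and>
      (\<forall>x \<in> R. M.twisted_product x j w = M.twisted_product x j w')" if law: "group_law G w w'" for w w' j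
  proof -
    have eq: "word_product K (g x j) w = word_product K (g x j) w'" if "x \<in> R" for x
      using lawK[OF law] grange[OF that] unfolding group_law_def by blast
    have tp1: "M.twisted_product \<one>\<^bsub>K\<^esub> j w = \<one>\<^bsub>K\<^esub>" for w
      using M.twisted_product_one M by simp
    \<comment> \<open>Substituting the identity for letter 0 isolates the power of
      \<open>y\<close>.\<close>
    have y: "y [^]\<^bsub>K\<^esub> exponent_sum j w = y [^]\<^bsub>K\<^esub> exponent_sum j w'"
      using eq[OF R.one_closed] y unfolding val[OF R.one_closed] tp1 by simp
    moreover have "M.twisted_product x j w = M.twisted_product x j w'" if "x \<in> R" for x
    proof -
      have tc: "M.twisted_product x j u \<in> carrier K" for u
        using M.twisted_product_closed[of x j u] that R.subset M by auto
      show ?thesis using eq[OF that] \<open>y \<in> carrier K\<close> tc unfolding val[OF that] y by simp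
    qed
    ultimately show ?thesis by blast
  qed
  obtain r where r: "r \<in> R" "r \<noteq> \<one>\<^bsub>K\<^esub>" using R(2) R.one_closed by blast
  have rM: "r \<in> carrier M" "r \<noteq> \<one>\<^bsub>M\<^esub>" using r M by simp_all
  show ?thesis
  proof (rule that[OF q])
    show "2 \<le> M.ord r"
      using M.ord_ge_1[OF M.fin rM(1)] M.ord_eq_1[OF rM(1)] rM(2) by linarith
  next
    fix w w' and i :: nat assume law: "group_law G w w'"
    \<comment> \<open>With this choice of \<open>j\<close> the exponent sum counts the letter
      \<open>Suc i\<close>.\<close>
    define j where "j k = (if k = i then 1 else 0 :: nat)" for k
    have e: "exponent_sum j w = count_list w (Suc i)" for w
    proof (induction w)
      case (Cons a w)
      then show ?case by (cases a) (auto simp: j_def)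
    qed simp
    have "(\<theta> ^^ count_list w (Suc i)) r = (\<theta> ^^ count_list w' (Suc i)) r"
      using tpeq[OF law, of j] r unfolding e by (simp add: pow)
    then show "[count_list w (Suc i) = count_list w' (Suc i)] (mod q)"
      by (rule M.funpow_eq_imp_cong[OF rM])
  next
    fix w w' m v assume "group_law G w w'" and w: "set w \<subseteq> {..m}" "set w' \<subseteq> {..m}"
    then show "[hits q m v w = hits q m v w'] (mod M.ord r)"
      using tpeq r by (intro M.hits_cong[OF rM(1) w]) blast
  qed
qed

section \<open>Identities of automatic algebras\<close>

text \<open>A product is never a group element, so a left factor that is itself a product makes a
  term constantly zero. The remaining terms are nested to the right: a list of left factors and a
  last variable.\<close>

fun spine :: "gterm \<Rightarrow> (nat list \<times> nat) option" where
  "spine (Var y) = Some ([], y)"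
| "spine (App (Var x) t) = map_option (\<lambda>(w, y). (x # w, y)) (spine t)"
| "spine (App (App _ _) _) = None"

definition the_Grp :: "('g, 's) aut_elem \<Rightarrow> 'g" where
  "the_Grp e = (case e of Grp g \<Rightarrow> g | _ \<Rightarrow> undefined)"

definition the_Pt :: "('g, 's) aut_elem \<Rightarrow> 's" where
  "the_Pt e = (case e of Pt s \<Rightarrow> s | _ \<Rightarrow> undefined)"

lemma the_Grp_Grp [simp]: "the_Grp (Grp g) = g"
  and the_Pt_Pt [simp]: "the_Pt (Pt s) = s"
  by (simp_all add: the_Grp_def the_Pt_def)

lemma spine_vars: "spine t = Some (w, y) \<Longrightarrow> vars t = insert y (set w)"
  by (induction t arbitrary: w y rule: spine.induct) auto

lemma spine_Nil: "spine t = Some ([], y) \<Longrightarrow> t = Var y"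
  by (cases t rule: spine.cases) auto

lemma aut_op_Zero [simp]: "aut_op C S \<alpha> x Zero = Zero"
  by (cases x) simp_all

lemma aut_op_aut_op [simp]: "aut_op C S \<alpha> (aut_op C S \<alpha> x y) z = Zero"
  by (cases x; cases y) simp_all

text \<open>Closure of \<open>S\<close> is all that is assumed of \<open>\<alpha>\<close>, so that
  the formula also serves the witness algebras. The case \<open>w = []\<close> stands apart because
  a lone variable may take any value.\<close>

lemma interp_automatic_algebra:
  assumes cl: "\<And>g s. g \<in> carrier G \<Longrightarrow> s \<in> S \<Longrightarrow> \<alpha> g s \<in> S"
    and v: "range v \<subseteq> carrier (automatic_algebra G S \<alpha>)"
  shows "interp (automatic_algebra G S \<alpha>) v t =
    (case spine t of None \<Rightarrow> Zero
     | Some (w, y) \<Rightarrow> if w = [] then v y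
         else if (\<forall>x \<in> set w. v x \<in> range Grp) \<and> v y \<in> range Pt
         then Pt (foldr (\<lambda>x. \<alpha> (the_Grp (v x))) w (the_Pt (v y))) else Zero)"
proof (induction t rule: spine.induct)
  case (2 x t)
  have mem: "v z \<in> Grp ` carrier G \<union> Pt ` S \<union> {Zero}" for z
    using v by (auto simp: automatic_algebra_def)
  have G: "the_Grp (v z) \<in> carrier G" if "v z \<in> range Grp" for z
    using mem[of z] that by auto
  have P: "the_Pt (v z) \<in> S" if "v z \<in> range Pt" for z
    using mem[of z] that by auto
  show ?case
  proof (cases "spine t")
    case (Some p)
    obtain w y where p: "p = (w, y)" by (cases p)
    define s where "s = foldr (\<lambda>x. \<alpha> (the_Grp (v x))) w (the_Pt (v y))"
    show ?thesis
    proof (cases "(\<forall>x \<in> set w. v x \<in> range Grp) \<and> v y \<in> range Pt")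
      case True
      have "foldr (\<lambda>x. \<alpha> (the_Grp (v x))) u (the_Pt (v y)) \<in> S" if "set u \<subseteq> set w" for u
        using that True G P cl by (induction u) auto
      then have "s \<in> S" by (simp add: s_def)
      moreover have "interp (automatic_algebra G S \<alpha>) v t = Pt s"
        using 2 Some p True by (auto simp: s_def)
      ultimately show ?thesis
        using Some p True G[of x] mem[of x]
        by (cases "v x") (auto simp: automatic_algebra_def s_def)
    next
      case False
      have "interp (automatic_algebra G S \<alpha>) v t \<notin> range Pt"
        using 2 Some p False by auto
      then have "aut_op (carrier G) S \<alpha> (v x) (interp (automatic_algebra G S \<alpha>) v t) = Zero"
        by (cases "v x"; cases "interp (automatic_algebra G S \<alpha>) v t") auto
      then show ?thesis using Some p False by (auto simp: automatic_algebra_def)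
    qed
  qed (use 2 in \<open>simp add: automatic_algebra_def\<close>)
qed (simp_all add: automatic_algebra_def)

text \<open>A last variable that is also a left factor would have to be a point and a group element
  at once. Terms without a spine are covered vacuously.\<close>

definition vanishing :: "gterm \<Rightarrow> bool" where
  "vanishing t \<longleftrightarrow> (\<forall>w y. spine t = Some (w, y) \<longrightarrow> y \<in> set w)"

lemma interp_vanishing:
  assumes cl: "\<And>g s. g \<in> carrier G \<Longrightarrow> s \<in> S \<Longrightarrow> \<alpha> g s \<in> S"
    and v: "range v \<subseteq> carrier (automatic_algebra G S \<alpha>)" and t: "vanishing t"
  shows "interp (automatic_algebra G S \<alpha>) v t = Zero"
proof (cases "spine t")
  case (Some p)
  obtain w y where p: "p = (w, y)" by (cases p)
  then have "y \<in> set w" using t Some by (simp add: vanishing_def)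
  then show ?thesis using interp_automatic_algebra[OF cl v] Some p by fastforce
qed (use interp_automatic_algebra[OF cl v] in simp)

text \<open>Equal letter sets make both terms nonzero under the same assignments; \<open>eq\<close>
  then compares the values.\<close>

lemma satisfies_automatic_algebraI:
  fixes G :: "('g, 'm) monoid_scheme" and S :: "'s set"
  assumes cl: "\<And>g s. g \<in> carrier G \<Longrightarrow> s \<in> S \<Longrightarrow> \<alpha> g s \<in> S"
    and s: "spine s = Some (w, y)" and t: "spine t = Some (w', y)"
    and ne: "w \<noteq> []" "w' \<noteq> []" and set: "set w = set w'"
    and eq: "\<And>g p. (\<And>x. x \<in> set w \<Longrightarrow> g x \<in> carrier G) \<Longrightarrow> p \<in> S \<Longrightarrow>
      foldr (\<lambda>x. \<alpha> (g x)) w p = foldr (\<lambda>x. \<alpha> (g x)) w' p"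
  shows "satisfies (automatic_algebra G S \<alpha>) s t"
  unfolding satisfies_def
proof (intro allI impI)
  fix v :: "nat \<Rightarrow> ('g, 's) aut_elem"
  assume v: "range v \<subseteq> carrier (automatic_algebra G S \<alpha>)"
  have mem: "v z \<in> Grp ` carrier G \<union> Pt ` S \<union> {Zero}" for z
    using v by (auto simp: automatic_algebra_def)
  have "foldr (\<lambda>x. \<alpha> (the_Grp (v x))) w (the_Pt (v y)) = foldr (\<lambda>x. \<alpha> (the_Grp (v x))) w' (the_Pt (v y))"
    if "\<forall>x \<in> set w. v x \<in> range Grp" "v y \<in> range Pt"
  proof (rule eq)
    show "the_Grp (v x) \<in> carrier G" if "x \<in> set w" for x
      using mem[of x] \<open>\<forall>x \<in> set w. _\<close> that by auto
    show "the_Pt (v y) \<in> S" using mem[of y] that by auto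
  qed
  then show "interp (automatic_algebra G S \<alpha>) v s = interp (automatic_algebra G S \<alpha>) v t"
    using interp_automatic_algebra[OF cl v] s t ne set by simp
qed

section \<open>The identities of a faithful action\<close>

locale nonempty_faithful_action = faithful_action +
  assumes nonempty: "E \<noteq> {}"
begin

abbreviation "\<A> \<equiv> automatic_algebra G E \<phi>"

lemma closed: "g \<in> carrier G \<Longrightarrow> s \<in> E \<Longrightarrow> \<phi> g s \<in> E"
  using element_image by blast

lemma group_G: "group G"
  using group_hom by (rule group_hom.axioms(1))

lemma foldr_action:
  assumes "\<And>x. x \<in> set w \<Longrightarrow> g x \<in> carrier G" "s \<in> E"
  shows "foldr (\<lambda>x. \<phi> (g x)) w s = \<phi> (word_product G g w) s \<and> word_product G g w \<in> carrier G"
proof -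
  interpret group G by (rule group_G)
  show ?thesis using assms
  proof (induction w)
    case Nil
    then show ?case using id_eq_one by (metis foldr.simps(1) id_apply one_closed restrict_apply' word_product.simps(1))
  next
    case (Cons a w)
    then have IH: "foldr (\<lambda>x. \<phi> (g x)) w s = \<phi> (word_product G g w) s" "word_product G g w \<in> carrier G"
      by auto
    have "g a \<in> carrier G" using Cons.prems by simp
    then show ?case using composition_rule[OF Cons.prems(2) _ IH(2)] IH by simp
  qed
qed

text \<open>The assignment sends \<open>y\<close> to a point, the letters of \<open>w\<close> to the
  identity and every other variable to zero. As \<open>s\<close> is then nonzero, so is
  \<open>t\<close>, which forces its shape.\<close>

lemma satisfies_imp_spine:
  assumes sat: "satisfies \<A> s t" and s: "spine s = Some (w, y)" "w \<noteq> []" "y \<notin> set w"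
    and t: "\<And>z. t \<noteq> Var z"
  shows "\<exists>w'. spine t = Some (w', y) \<and> set w' \<subseteq> set w"
proof -
  interpret group G by (rule group_G)
  obtain p where p: "p \<in> E" using nonempty by blast
  define v :: "nat \<Rightarrow> ('a, 'c) aut_elem" where
    "v z = (if z = y then Pt p else if z \<in> set w then Grp \<one> else Zero)" for z
  have v: "range v \<subseteq> carrier \<A>" using p by (auto simp: v_def automatic_algebra_def)
  note I = interp_automatic_algebra[OF closed v]
  have "interp \<A> v s \<noteq> Zero" using I[of s] s by (auto simp: v_def)
  then have nz: "interp \<A> v t \<noteq> Zero" using sat v by (simp add: satisfies_def)
  then obtain w' y' where t': "spine t = Some (w', y')" using I[of t] by (cases "spine t") auto
  have "w' \<noteq> []" using t' spine_Nil t by blast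
  then have *: "\<forall>x \<in> set w'. v x \<in> range Grp" "v y' \<in> range Pt"
    using nz I[of t] t' by (auto split: if_splits)
  have "y' = y" using *(2) by (auto simp: v_def split: if_splits)
  moreover have "set w' \<subseteq> set w" using *(1) by (auto simp: v_def split: if_splits)
  ultimately show ?thesis using t' by blast
qed

text \<open>Letting \<open>y\<close> range over all points shows that the two group elements act
  alike, and faithfulness makes them equal.\<close>

lemma satisfies_imp_group_law:
  assumes sat: "satisfies \<A> s t" and s: "spine s = Some (w, y)" "w \<noteq> []" "y \<notin> set w"
    and t: "spine t = Some (w', y)" "w' \<noteq> []" "y \<notin> set w'"
  shows "group_law G w w'"
  unfolding group_law_def
proof (intro allI impI)
  interpret group G by (rule group_G)
  fix g :: "nat \<Rightarrow> 'a" assume g: "range g \<subseteq> carrier G"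
  have "\<phi> (word_product G g w) p = \<phi> (word_product G g w') p" if p: "p \<in> E" for p
  proof -
    define v :: "nat \<Rightarrow> ('a, 'c) aut_elem" where "v z = (if z = y then Pt p else Grp (g z))" for z
    have v: "range v \<subseteq> carrier \<A>" using p g by (auto simp: v_def automatic_algebra_def)
    note I = interp_automatic_algebra[OF closed v]
    have val: "interp \<A> v u = Pt (\<phi> (word_product G g x) p)"
      if u: "spine u = Some (x, y)" "x \<noteq> []" "y \<notin> set x" for u x
    proof -
      have "foldr (\<lambda>x. \<phi> (the_Grp (v x))) x p = foldr (\<lambda>x. \<phi> (g x)) x p"
        using u(3) by (intro foldr_cong) (auto simp: v_def)
      also have "\<dots> = \<phi> (word_product G g x) p" using foldr_action[of x g p] g p by auto
      finally show ?thesis using I[of u] u by (auto simp: v_def)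
    qed
    show ?thesis using val[OF s] val[OF t] sat v by (simp add: satisfies_def)
  qed
  moreover have wc: "word_product G g u \<in> carrier G" for u by (rule word_product_closed[OF g])
  ultimately have "\<phi> (word_product G g w) = \<phi> (word_product G g w')"
    using bij_prop0[OF wc] by (intro extensionalityI[of _ E]) (auto simp: Bij_def)
  then show "word_product G g w = word_product G g w'" using faithful wc by (simp add: inj_on_def)
qed

text \<open>For terms that are neither variables nor vanishing, \<open>satisfies_imp_spine\<close>
  is applied in both directions, which gives equality of the letter sets.\<close>

lemma satisfies_cases:
  assumes sat: "satisfies \<A> s t"
  obtains "s = t" | "vanishing s" "vanishing t"
  | w w' y where "spine s = Some (w, y)" "spine t = Some (w', y)" "w \<noteq> []" "w' \<noteq> []"
    "y \<notin> set w" "set w = set w'" "group_law G w w'"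
proof -
  interpret group G by (rule group_G)
  have sym: "satisfies \<A> t s" using sat by (simp add: satisfies_def)
  \<comment> \<open>A variable is told apart from another variable by assigning zero to just one of
    them, and from a product by assigning group elements, which no product yields.\<close>
  have var: "s = t" if "satisfies \<A> s t" "s = Var y" for s t y
  proof (cases t)
    case (Var z)
    define v :: "nat \<Rightarrow> ('a, 'c) aut_elem" where "v i = (if i = y then Zero else Grp \<one>)" for i
    have "range v \<subseteq> carrier \<A>" by (auto simp: v_def automatic_algebra_def)
    then have "v y = v z" using that Var by (auto simp: satisfies_def)
    then show ?thesis using that Var by (auto simp: v_def split: if_splits)
  next
    case (App t1 t2)
    define v :: "nat \<Rightarrow> ('a, 'c) aut_elem" where "v i = Grp \<one>" for i
    have "range v \<subseteq> carrier \<A>" by (auto simp: v_def automatic_algebra_def)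
    then have "interp \<A> v s = interp \<A> v t" using that by (simp add: satisfies_def)
    then have "Grp \<one> = aut_op (carrier G) E \<phi> (interp \<A> v t1) (interp \<A> v t2)"
      using that(2) App by (simp add: v_def automatic_algebra_def)
    then show ?thesis
      by (cases "interp \<A> v t1"; cases "interp \<A> v t2") (auto split: if_splits)
  qed
  have main: "\<exists>w w' y. spine s = Some (w, y) \<and> spine t = Some (w', y) \<and> w \<noteq> [] \<and> w' \<noteq> [] \<and>
    y \<notin> set w \<and> set w = set w' \<and> group_law G w w'"
    if st: "satisfies \<A> s t" "satisfies \<A> t s" "\<not> vanishing s" "\<And>y. s \<noteq> Var y" "\<And>y. t \<noteq> Var y" for s t
  proof -
    obtain w y where s: "spine s = Some (w, y)" "y \<notin> set w"
      using \<open>\<not> vanishing s\<close> by (auto simp: vanishing_def)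
    have w: "w \<noteq> []" using s spine_Nil st by blast
    obtain w' where t: "spine t = Some (w', y)" "set w' \<subseteq> set w"
      using satisfies_imp_spine[OF st(1) s(1) w s(2) st(5)] by blast
    have w': "w' \<noteq> []" using t spine_Nil st by blast
    have y': "y \<notin> set w'" using t s by blast
    have "set w \<subseteq> set w'" using satisfies_imp_spine[OF st(2) t(1) w' y' st(4)] s by auto
    then show ?thesis using s t w w' y' satisfies_imp_group_law[OF st(1) s(1) w s(2) t(1) w' y'] by blast
  qed
  show ?thesis
  proof (cases "(\<exists>y. s = Var y) \<or> (\<exists>y. t = Var y)")
    case True
    then have "s = t" using var[OF sat] var[OF sym] by blast
    then show ?thesis by (rule that(1))
  next
    case nv: False
    show ?thesis
    proof (cases "vanishing s \<and> vanishing t")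
      case False
      then have "\<exists>w w' y. spine s = Some (w, y) \<and> spine t = Some (w', y) \<and> w \<noteq> [] \<and> w' \<noteq> [] \<and>
        y \<notin> set w \<and> set w = set w' \<and> group_law G w w'"
      proof (cases "vanishing s")
        case True
        then have "\<not> vanishing t" using False by blast
        then show ?thesis using main[OF sym sat] nv True by (force simp: vanishing_def)
      qed (use main[OF sat sym] nv in blast)
      then show ?thesis using that(3) by blast
    qed (use that(2) in blast)
  qed
qed

end

section \<open>Large finitely generated algebras\<close>

definition block_cycle :: "nat \<Rightarrow> nat \<Rightarrow> nat \<Rightarrow> nat" where
  "block_cycle n N u = (if u < n * N then n * (u div n) + (u + 1) mod n else u)"

text \<open>Both permutations rotate \<open>N\<close> blocks of \<open>n\<close> consecutive numbers
  up to \<open>n * N\<close>. The blocks of \<open>block_cycle\<close> start at 0 and leave out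
  \<open>n * N\<close>, those here start at 1 and leave out 0, so that for \<open>n \<ge> 2\<close>
  each family bridges the gaps of the other.\<close>

definition shifted_block_cycle :: "nat \<Rightarrow> nat \<Rightarrow> nat \<Rightarrow> nat" where
  "shifted_block_cycle n N u = (if u = 0 then 0 else Suc (block_cycle n N (u - 1)))"

lemma block_cycle_less:
  assumes "u < n * N"
  shows "block_cycle n N u < n * N"
proof -
  have n: "n > 0" using assms by (cases n) auto
  have "u div n < N" using assms n by (simp add: less_mult_imp_div_less mult.commute)
  then have "n * (u div n) + n \<le> n * N" by (metis Suc_leI mult_Suc_right mult_le_mono2 add.commute)
  moreover have "(u + 1) mod n < n" using n by simp
  ultimately show ?thesis using assms by (simp add: block_cycle_def)
qed

lemma block_cycle_funpow:
  assumes "b < N" "r < n"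
  shows "(block_cycle n N ^^ k) (n * b + r) = n * b + (r + k) mod n"
proof (induction k)
  case (Suc k)
  have "n * b + n \<le> n * N" using assms(1) by (metis Suc_leI mult_Suc_right mult_le_mono2 add.commute)
  moreover have "(r + k) mod n < n" using assms by simp
  ultimately have "n * b + (r + k) mod n < n * N" by linarith
  then show ?case using Suc assms by (simp add: block_cycle_def mod_Suc_eq)
qed (use assms in simp)

lemma block_cycle_period: "(block_cycle n N ^^ n) u = u"
proof (cases "u < n * N")
  case True
  then have n: "n > 0" by (cases n) auto
  have "u div n < N" using True n by (simp add: less_mult_imp_div_less mult.commute)
  then show ?thesis using block_cycle_funpow[of "u div n" N "u mod n" n n] n by simp
next
  case False
  then have "(block_cycle n N ^^ k) u = u" for k by (induction k) (simp_all add: block_cycle_def)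
  then show ?thesis .
qed

lemma shifted_block_cycle_period: "(shifted_block_cycle n N ^^ n) u = u"
proof (cases u)
  case 0
  have "(shifted_block_cycle n N ^^ k) 0 = 0" for k
    by (induction k) (simp_all add: shifted_block_cycle_def)
  then show ?thesis using 0 by simp
next
  case (Suc u')
  have "(shifted_block_cycle n N ^^ k) (Suc u') = Suc ((block_cycle n N ^^ k) u')" for k
    by (induction k) (simp_all add: shifted_block_cycle_def)
  then show ?thesis using Suc block_cycle_period by simp
qed

lemma block_cycle_le: "u \<le> n * N \<Longrightarrow> block_cycle n N u \<le> n * N"
  using block_cycle_less[of u n N] by (cases "u < n * N") (auto simp: block_cycle_def)

lemma shifted_block_cycle_le: "u \<le> n * N \<Longrightarrow> shifted_block_cycle n N u \<le> n * N"
  using block_cycle_less[of "u - 1" n N]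
  by (cases u) (auto simp: shifted_block_cycle_def Suc_le_eq)

text \<open>\<open>block_cycle\<close> fails to pass to the successor only at the end of a block,
  and for \<open>n \<ge> 2\<close> this number is not the end of a shifted block.\<close>

lemma block_cycle_step:
  assumes "n \<ge> 2" "u < n * N"
  shows "block_cycle n N u = Suc u \<or> shifted_block_cycle n N u = Suc u"
proof (cases "Suc u mod n = 0")
  case False
  then have "Suc u mod n = Suc (u mod n)" by (simp add: mod_Suc split: if_splits)
  then show ?thesis using assms by (simp add: block_cycle_def)
next
  case True
  then have u: "Suc (u mod n) = n" by (simp add: mod_Suc split: if_splits)
  then have "u \<noteq> 0" using assms by (intro notI) simp
  then obtain k where k: "u = Suc k" by (cases u) auto
  have "Suc k mod n \<noteq> 0" using u assms k by (intro notI) simp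
  then have "Suc k mod n = Suc (k mod n)" by (simp add: mod_Suc split: if_splits)
  then have "block_cycle n N k = Suc k" using assms k by (simp add: block_cycle_def)
  then show ?thesis using k by (simp add: shifted_block_cycle_def)
qed

text \<open>A word that lacks a letter \<open>e\<^sub>i\<close> cannot move between the points \<open>(0, \<dots>, 0)\<close> and
  \<open>(1, \<dots>, 1)\<close>.\<close>

fun letter_action :: "nat \<Rightarrow> nat \<Rightarrow> nat \<Rightarrow> nat \<Rightarrow> nat \<Rightarrow> nat \<times> (nat \<Rightarrow> nat) \<Rightarrow> nat \<times> (nat \<Rightarrow> nat)" where
  "letter_action q m n N 0 (u, a) =
     (if \<forall>i<m. a i = 0 then block_cycle n N u
      else if \<forall>i<m. a i = 1 then shifted_block_cycle n N u else u, a)"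
| "letter_action q m n N (Suc i) (u, a) = (u, a(i := (a i + 1) mod q))"

definition points :: "nat \<Rightarrow> nat \<Rightarrow> nat \<Rightarrow> nat \<Rightarrow> (nat \<times> (nat \<Rightarrow> nat)) set" where
  "points q m n N = {..n * N} \<times> (PiE {..<m} (\<lambda>_. {..<q}))"

lemma PiE_fun_upd_mem:
  assumes "a \<in> PiE A B" "i \<in> A" "c \<in> B i"
  shows "a(i := c) \<in> PiE A B"
  using PiE_fun_upd[of c B i a A] assms by (simp add: insert_absorb)

lemma letter_action_closed:
  assumes "q > 0" "l \<le> m" "p \<in> points q m n N"
  shows "letter_action q m n N l p \<in> points q m n N"
proof (cases l)
  case 0
  obtain u a where "p = (u, a)" by (cases p)
  then show ?thesis using assms 0 block_cycle_le shifted_block_cycle_le by (auto simp: points_def)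
next
  case (Suc i)
  obtain u a where p: "p = (u, a)" by (cases p)
  have "a(i := (a i + 1) mod q) \<in> PiE {..<m} (\<lambda>_. {..<q})"
    by (rule PiE_fun_upd_mem) (use assms p Suc in \<open>auto simp: points_def\<close>)
  then show ?thesis using assms p Suc by (auto simp: points_def)
qed

text \<open>Without the letter \<open>Suc i0\<close> the coordinate \<open>i0\<close> keeps its
  value, so at most one of the two special fibres can be visited and a single permutation
  \<open>\<rho>\<close> acts, once per hit. Adding \<open>q - 1\<close> to the start subtracts 1
  modulo \<open>q\<close> and turns visits of the all-ones position into hits.\<close>

lemma foldr_letter_action:
  fixes a :: "nat \<Rightarrow> nat" and n N :: nat
  assumes q: "q > 1" and i0: "i0 < m" "Suc i0 \<notin> set w" and w: "set w \<subseteq> {..m}"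
    and a: "a \<in> PiE {..<m} (\<lambda>_. {..<q})"
  defines "\<rho> \<equiv> if a i0 = 0 then block_cycle n N else if a i0 = 1 then shifted_block_cycle n N else id"
    and "v \<equiv> if a i0 = 0 then a else (\<lambda>i. a i + (q - 1))"
  shows "foldr (letter_action q m n N) w (u, a) =
    ((\<rho> ^^ hits q m v w) u, \<lambda>i\<in>{..<m}. (a i + count_list w (Suc i)) mod q)"
  using i0(2) w
proof (induction w)
  case Nil
  have "(\<lambda>i\<in>{..<m}. (a i + count_list [] (Suc i)) mod q) = a"
    using a by (intro ext) (auto simp: restrict_def PiE_def extensional_def Pi_def)
  then show ?case by simp
next
  case (Cons l w)
  define c where "c = (\<lambda>i\<in>{..<m}. (a i + count_list w (Suc i)) mod q)"
  have IH: "foldr (letter_action q m n N) w (u, a) = ((\<rho> ^^ hits q m v w) u, c)"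
    unfolding c_def by (rule Cons.IH) (use Cons.prems in auto)
  show ?case
  proof (cases l)
    case (Suc i)
    have "c(i := (c i + 1) mod q) = (\<lambda>k\<in>{..<m}. (a k + count_list (l # w) (Suc k)) mod q)"
      using Suc Cons.prems by (intro ext) (auto simp: c_def mod_Suc_eq)
    then show ?thesis unfolding foldr.simps comp_apply IH using Suc
      by (metis hits.simps(3) letter_action.simps(2))
  next
    case 0
    have ai: "a i0 < q" using a i0 by auto
    have ci: "c i0 = a i0" using Cons.prems ai i0 by (simp add: c_def count_list_0_iff)
    have cc: "(\<lambda>k\<in>{..<m}. (a k + count_list (l # w) (Suc k)) mod q) = c"
      unfolding c_def using 0 by (intro restrict_ext) simp
    have c0: "(\<forall>i<m. c i = 0) \<longleftrightarrow> (\<forall>i<m. q dvd a i + count_list w (Suc i))"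
      by (auto simp: c_def dvd_eq_mod_eq_0)
    have one: "t mod q = 1 \<longleftrightarrow> q dvd t + (q - 1)" for t
    proof -
      have "[t = 1] (mod q) \<longleftrightarrow> [t + (q - 1) = 1 + (q - 1)] (mod q)"
        by (simp only: cong_add_rcancel_nat)
      then show ?thesis using q by (simp add: cong_def dvd_eq_mod_eq_0)
    qed
    have c1: "(\<forall>i<m. c i = 1) \<longleftrightarrow> (\<forall>i<m. q dvd a i + (q - 1) + count_list w (Suc i))"
      using one by (simp add: c_def add.assoc add.commute add.left_commute)
    have "letter_action q m n N 0 ((\<rho> ^^ hits q m v w) u, c) = ((\<rho> ^^ hits q m v (0 # w)) u, c)"
    proof (cases "a i0 = 0")
      case True
      then have "\<not> (\<forall>i<m. c i = 1)" using ci i0 by auto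
      then show ?thesis using True c0 by (auto simp: \<rho>_def v_def)
    next
      case False
      then have n0: "\<not> (\<forall>i<m. c i = 0)" using ci i0 by auto
      show ?thesis
      proof (cases "a i0 = 1")
        case True
        then show ?thesis using n0 c1 by (auto simp: \<rho>_def v_def)
      next
        case F: False
        then have "\<not> (\<forall>i<m. c i = 1)" using ci i0 by auto
        then show ?thesis using n0 False F by (auto simp: \<rho>_def)
      qed
    qed
    then show ?thesis unfolding cc using IH 0 by (simp del: hits.simps letter_action.simps)
  qed
qed

text \<open>The letter counts modulo \<open>q\<close> determine the second component. The first is
  moved by a power of \<open>\<rho>\<close>, whose exponent matters only modulo \<open>n\<close> as
  both block rotations have period \<open>n\<close>.\<close>

lemma foldr_letter_action_cong:
  assumes q: "q > 1" and i0: "i0 < m" "Suc i0 \<notin> set w" and w: "set w \<subseteq> {..m}" "set w' = set w"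
    and count: "\<And>i. [count_list w (Suc i) = count_list w' (Suc i)] (mod q)"
    and hits: "\<And>v. [hits q m v w = hits q m v w'] (mod n)"
    and p: "p \<in> points q m n N"
  shows "foldr (letter_action q m n N) w p = foldr (letter_action q m n N) w' p"
proof -
  obtain u a where ua: "p = (u, a)" by (cases p)
  have a: "a \<in> PiE {..<m} (\<lambda>_. {..<q})" using p ua by (simp add: points_def)
  have "(f ^^ hits q m v w) u = (f ^^ hits q m v w') u" if "(f ^^ n) u = u" for f v
    using hits[of v] funpow_mod_eq[of n f u, OF that] unfolding cong_def by metis
  moreover have "(a i + count_list w (Suc i)) mod q = (a i + count_list w' (Suc i)) mod q" for i
    using cong_add[OF cong_refl count[of i], of "a i"] unfolding cong_def .
  moreover have "(id ^^ n) u = u" by simp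
  ultimately show ?thesis
    using foldr_letter_action[OF q i0 w(1) a, of n N u]
      foldr_letter_action[OF q i0(1) _ _ a, of w' n N u] i0 w
      block_cycle_period[of n N u] shifted_block_cycle_period[of n N u]
    unfolding ua by (simp add: cong: restrict_cong)
qed

text \<open>The first argument is the bare set of letters instead of the group that they generate,
  so that \<open>m + 1\<close> letters and one point can generate everything.\<close>

definition witness :: "nat \<Rightarrow> nat \<Rightarrow> nat \<Rightarrow> nat \<Rightarrow> (nat, nat \<times> (nat \<Rightarrow> nat)) aut_elem groupoid" where
  "witness q m n N = automatic_algebra \<lparr>carrier = {..m}, monoid.mult = \<lambda>_ _. 0, one = 0\<rparr>
     (points q m n N) (letter_action q m n N)"

lemma carrier_witness: "carrier (witness q m n N) = Grp ` {..m} \<union> Pt ` points q m n N \<union> {Zero}"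
  by (simp add: witness_def automatic_algebra_def)

lemma witness_op:
  "l \<le> m \<Longrightarrow> p \<in> points q m n N \<Longrightarrow> Grp l \<cdot>\<^bsub>witness q m n N\<^esub> Pt p = Pt (letter_action q m n N l p)"
  "Grp l \<cdot>\<^bsub>witness q m n N\<^esub> Grp l' = Zero"
  by (simp_all add: witness_def automatic_algebra_def)

lemma is_groupoid_witness:
  assumes "q > 0"
  shows "is_groupoid (witness q m n N)"
proof -
  have "aut_op {..m} (points q m n N) (letter_action q m n N) x y
      \<in> Grp ` {..m} \<union> Pt ` points q m n N \<union> {Zero}" for x y
    using letter_action_closed[OF assms] by (cases x; cases y) auto
  then show ?thesis by (simp add: is_groupoid_def witness_def automatic_algebra_def)
qed

lemma finite_points: "finite (points q m n N)"
  by (auto simp: points_def intro: finite_PiE)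

text \<open>The generators are the letters and the point \<open>(0, z)\<close>. The letters
  \<open>Suc i\<close> reach every point with the same first component; letter 0, applied over all
  zeros or over all ones, raises that component by \<open>block_cycle_step\<close>.\<close>

lemma generated_witness:
  assumes q: "q > 1" and m: "m > 0" and n: "n \<ge> 2"
  shows "generated_by_at_most (m + 2) (witness q m n N)"
proof -
  define J where "J = PiE {..<m} (\<lambda>_. {..<q})"
  define z where "z = (\<lambda>i\<in>{..<m}. 0::nat)"
  define X :: "(nat, nat \<times> (nat \<Rightarrow> nat)) aut_elem set" where "X = insert (Pt (0, z)) (Grp ` {..m})"
  let ?B = "witness q m n N"
  let ?g = "generated ?B X"
  have z: "z \<in> J" using q by (auto simp: z_def J_def)
  have P: "(u, a) \<in> points q m n N \<longleftrightarrow> u \<le> n * N \<and> a \<in> J" for u a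
    by (auto simp: points_def J_def)
  have X: "X \<subseteq> carrier ?B" using z P by (auto simp: X_def carrier_witness)
  have "?g \<subseteq> carrier ?B"
  proof
    fix x assume "x \<in> ?g"
    then show "x \<in> carrier ?B"
      by (induction rule: generated.induct)
        (use X is_groupoid_witness[of q m n N] q in \<open>auto simp: is_groupoid_def\<close>)
  qed
  moreover have G: "Grp l \<in> ?g" if "l \<le> m" for l using that by (auto simp: X_def intro: generated.incl)
  moreover have "Zero \<in> ?g" using generated.app[OF G[of 0] G[of 0]] by (simp add: witness_op)
  moreover have "Pt p \<in> ?g" if "p \<in> points q m n N" for p
  proof -
    have step: "Pt (letter_action q m n N l (u, a)) \<in> ?g"
      if "Pt (u, a) \<in> ?g" "l \<le> m" "u \<le> n * N" "a \<in> J" for l u a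
      using generated.app[OF G[OF that(2)] that(1)] that P by (simp add: witness_op)
    have upd: "Pt (u, a(i := c)) \<in> ?g"
      if "Pt (u, a) \<in> ?g" "i < m" "c < q" "u \<le> n * N" "a \<in> J" for u a i c
    proof -
      have ai: "a i < q" using that by (auto simp: J_def)
      have "Pt (u, a(i := (a i + k) mod q)) \<in> ?g" for k
      proof (induction k)
        case 0
        then show ?case using that ai by simp
      next
        case (Suc k)
        have "a(i := (a i + k) mod q) \<in> J" unfolding J_def
          by (rule PiE_fun_upd_mem) (use that q in \<open>auto simp: J_def\<close>)
        from step[OF Suc _ _ this, of "Suc i"]
        have "Pt (u, (a(i := (a i + k) mod q))(i := ((a i + k) mod q + 1) mod q)) \<in> ?g"
          using that by simp
        moreover have "((a i + k) mod q + 1) mod q = (a i + Suc k) mod q" by (simp add: mod_Suc_eq)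
        ultimately show ?case by (simp only: fun_upd_upd)
      qed
      \<comment> \<open>So many rotations lead from \<open>a i\<close> to \<open>c\<close>; the
        summand \<open>q\<close> keeps the natural subtraction from being cut off.\<close>
      from this[of "c + q - a i"] show ?thesis using ai that(3) by simp
    qed
    have all: "Pt (u, b) \<in> ?g" if ua: "Pt (u, a) \<in> ?g" "u \<le> n * N" "a \<in> J" "b \<in> J" for u a b
    proof -
      have "k \<le> m \<Longrightarrow> Pt (u, \<lambda>i. if i < k then b i else a i) \<in> ?g \<and> (\<lambda>i. if i < k then b i else a i) \<in> J" for k
      proof (induction k)
        case (Suc k)
        let ?c = "\<lambda>i. if i < k then b i else a i"
        have e: "(\<lambda>i. if i < Suc k then b i else a i) = ?c(k := b k)" by auto
        have "b k \<in> {..<q}"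
          by (rule PiE_mem[OF ua(4)[unfolded J_def]]) (use Suc.prems in simp)
        then have bk: "b k < q" by simp
        have IH: "Pt (u, ?c) \<in> ?g" "?c \<in> J" "k < m" using Suc by simp_all
        have "?c(k := b k) \<in> J" unfolding J_def
          by (rule PiE_fun_upd_mem[OF IH(2)[unfolded J_def]]) (use IH(3) bk in simp_all)
        moreover have "Pt (u, ?c(k := b k)) \<in> ?g" by (rule upd[OF IH(1,3) bk ua(2) IH(2)])
        ultimately show ?case unfolding e by blast
      qed (use ua in simp)
      from this[of m] have "Pt (u, \<lambda>i. if i < m then b i else a i) \<in> ?g" by simp
      moreover have "(\<lambda>i. if i < m then b i else a i) = b"
        using ua by (intro ext) (auto simp: J_def PiE_def extensional_def)
      ultimately show ?thesis by simp
    qed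
    have "u \<le> n * N \<Longrightarrow> \<forall>a \<in> J. Pt (u, a) \<in> ?g" for u
    proof (induction u)
      case 0
      have "Pt (0, z) \<in> ?g" by (simp add: X_def generated.incl)
      then show ?case using all z by blast
    next
      case (Suc u)
      \<comment> \<open>The position of the second fibre. \<open>m > 0\<close> keeps it apart from
        the zero position, which \<open>letter_action\<close> tests first.\<close>
      define o1 where "o1 = (\<lambda>i\<in>{..<m}. 1::nat)"
      have o1: "o1 \<in> J" using q by (auto simp: o1_def J_def)
      have u: "u < n * N" using Suc by simp
      from block_cycle_step[OF n u] have "\<exists>a \<in> J. Pt (Suc u, a) \<in> ?g"
      proof
        assume "block_cycle n N u = Suc u"
        then show ?thesis using step[of u z 0] Suc z by (auto simp: z_def intro!: bexI[of _ z])
      next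
        assume "shifted_block_cycle n N u = Suc u"
        moreover have "(\<forall>i<m. o1 i = 0) = False" "(\<forall>i<m. o1 i = 1) = True"
          using m by (auto simp: o1_def)
        ultimately have "letter_action q m n N 0 (u, o1) = (Suc u, o1)"
          by (simp only: letter_action.simps if_False if_True)
        moreover have "Pt (letter_action q m n N 0 (u, o1)) \<in> ?g"
          by (rule step) (use Suc o1 in auto)
        ultimately show ?thesis using o1 by auto
      qed
      then show ?case using all Suc by blast
    qed
    then show ?thesis using that P by (cases p) blast
  qed
  ultimately have "?g = carrier ?B" unfolding carrier_witness by blast
  moreover have "card X \<le> m + 2"
    unfolding X_def by (metis One_nat_def add_2_eq_Suc' card_atMost card_image_le card_insert_le_m1 diff_Suc_1 finite_atMost zero_less_Suc)
  moreover have "finite X" by (simp add: X_def)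
  ultimately show ?thesis using X unfolding generated_by_at_most_def by blast
qed

text \<open>Structure is transported along a bijection \<open>h\<close> onto an initial segment of
  the natural numbers, where the witnesses are required to live.\<close>

lemma nat_copy_of_finite_groupoid:
  fixes C :: "'c groupoid" and A :: "'a groupoid"
  assumes C: "C \<in> variety_n A k" and fin: "finite (carrier C)" and gen: "generated_by_at_most d C"
  obtains B :: "nat groupoid" where "B \<in> variety_n A k" "finite (carrier B)"
    "generated_by_at_most d B" "card (carrier B) = card (carrier C)"
proof -
  obtain h where h: "bij_betw h (carrier C) {0..<card (carrier C)}"
    using ex_bij_betw_finite_nat[OF fin] by blast
  define f where "f = inv_into (carrier C) h"
  define B :: "nat groupoid" where "B = \<lparr>carrier = h ` carrier C, op = \<lambda>x y. h (f x \<cdot>\<^bsub>C\<^esub> f y)\<rparr>"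
  have inj: "inj_on h (carrier C)" using h by (rule bij_betw_imp_inj_on)
  have fh: "f (h x) = x" if "x \<in> carrier C" for x using inj that by (simp add: f_def)
  have hf: "h (f x) = x" "f x \<in> carrier C" if "x \<in> carrier B" for x
    using that by (auto simp: B_def f_def f_inv_into_f inv_into_into)
  have cB: "carrier B = h ` carrier C" by (simp add: B_def)
  have opB: "x \<cdot>\<^bsub>B\<^esub> y = h (f x \<cdot>\<^bsub>C\<^esub> f y)" for x y by (simp add: B_def)
  have gC: "carrier C \<noteq> {}" "\<And>x y. x \<in> carrier C \<Longrightarrow> y \<in> carrier C \<Longrightarrow> x \<cdot>\<^bsub>C\<^esub> y \<in> carrier C"
    using C by (auto simp: variety_n_def is_groupoid_def)
  have ic: "interp C v t \<in> carrier C" if "range v \<subseteq> carrier C" for v t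
    using that gC by (induction t) auto
  have sat: "satisfies B s t" if st: "satisfies C s t" for s t
    unfolding satisfies_def
  proof (intro allI impI)
    fix v :: "nat \<Rightarrow> nat" assume v: "range v \<subseteq> carrier B"
    have fv: "range (f \<circ> v) \<subseteq> carrier C" using v hf by auto
    have val: "interp B v u = h (interp C (f \<circ> v) u)" for u
    proof (induction u)
      case (Var i)
      then show ?case using hf v by (simp add: subset_iff)
    next
      case (App s t)
      show ?case by (simp only: interp.simps opB App fh[OF ic[OF fv]])
    qed
    show "interp B v s = interp B v t" using st fv unfolding val satisfies_def by simp
  qed
  have "is_groupoid B" using gC hf by (auto simp: is_groupoid_def cB opB fh)
  then have "B \<in> variety_n A k" using C sat by (auto simp: variety_n_def)
  moreover have "finite (carrier B)" using fin cB by simp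
  moreover have "generated_by_at_most d B"
  proof -
    obtain X where X: "X \<subseteq> carrier C" "finite X" "card X \<le> d" "generated C X = carrier C"
      using gen by (auto simp: generated_by_at_most_def)
    have img: "x \<in> generated C X \<Longrightarrow> h x \<in> generated B (h ` X)" for x
    proof (induction rule: generated.induct)
      case (app x y)
      then have "h x \<cdot>\<^bsub>B\<^esub> h y = h (x \<cdot>\<^bsub>C\<^esub> y)" using fh X(4) opB by auto
      then show ?case using generated.app[OF app.IH] by simp
    qed (simp add: generated.incl)
    have "carrier B \<subseteq> generated B (h ` X)"
      unfolding cB X(4)[symmetric] by (rule image_subsetI) (rule img)
    moreover have "generated B (h ` X) \<subseteq> carrier B"
    proof
      fix z assume "z \<in> generated B (h ` X)"
      then show "z \<in> carrier B"
        by (induction rule: generated.induct)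
          (use X(1) cB \<open>is_groupoid B\<close> in \<open>auto simp: is_groupoid_def\<close>)
    qed
    moreover have "card (h ` X) \<le> d" using card_image_le[OF X(2), of h] X(3) by linarith
    ultimately show ?thesis unfolding generated_by_at_most_def
      using X(1,2) cB by (intro exI[of _ "h ` X"]) auto
  qed
  moreover have "card (carrier B) = card (carrier C)" unfolding cB by (rule card_image[OF inj])
  ultimately show ?thesis by (rule that)
qed

text \<open>The witness has \<open>k\<close> letters of the form \<open>Suc i\<close>. In an
  identity of the third kind one of at most \<open>k\<close> variables is the point, so fewer than
  \<open>k\<close> letters are used and some \<open>Suc i0\<close> is missing, as
  \<open>foldr_letter_action_cong\<close> demands.\<close>

lemma (in nonempty_faithful_action) witness_in_variety_n:
  assumes q: "q > 1" and k: "k > 0"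
    and count: "\<And>w w' i. group_law G w w' \<Longrightarrow> [count_list w (Suc i) = count_list w' (Suc i)] (mod q)"
    and hits: "\<And>w w' m v. group_law G w w' \<Longrightarrow> set w \<subseteq> {..m} \<Longrightarrow> set w' \<subseteq> {..m} \<Longrightarrow>
      [hits q m v w = hits q m v w'] (mod n)"
  shows "witness q k n N \<in> variety_n \<A> k"
proof -
  let ?L = "\<lparr>carrier = {..k}, monoid.mult = \<lambda>_ _. 0, one = 0\<rparr> :: nat monoid"
  have cl: "letter_action q k n N l p \<in> points q k n N" if "l \<in> carrier ?L" "p \<in> points q k n N" for l p
    using letter_action_closed[of q l k p n N] that q by simp
  have "satisfies (witness q k n N) s t" if small: "card (vars s \<union> vars t) \<le> k" and st: "satisfies \<A> s t" for s t
    using st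
  proof (cases rule: satisfies_cases)
    case 1
    then show ?thesis by (simp add: satisfies_def)
  next
    case 2
    show ?thesis unfolding satisfies_def witness_def
      by (intro allI impI) (simp only: interp_vanishing[OF cl _ 2(1)] interp_vanishing[OF cl _ 2(2)])
  next
    case (3 w w' y)
    show ?thesis unfolding witness_def
    proof (rule satisfies_automatic_algebraI[OF cl 3(1,2,3,4,6)])
      fix g p assume g: "\<And>x. x \<in> set w \<Longrightarrow> g x \<in> carrier ?L" and p: "p \<in> points q k n N"
      have law: "group_law G (map g w) (map g w')" by (rule group_law_map[OF 3(7)])
      have sub: "set (map g w) \<subseteq> {..k}" "set (map g w') = set (map g w)" using g 3(6) by auto
      have "vars s \<union> vars t = insert y (set w)" using spine_vars[OF 3(1)] spine_vars[OF 3(2)] 3(6) by simp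
      then have "card (set w) < k" using small 3(5) by simp
      then have "card (set (map g w)) < card (Suc ` {..<k})"
        using card_image_le[of "set w" g] by (simp add: card_image)
      then have "\<not> Suc ` {..<k} \<subseteq> set (map g w)" by (meson card_mono finite_set not_le)
      then obtain i0 where i0: "i0 < k" "Suc i0 \<notin> set (map g w)" by auto
      have "foldr (letter_action q k n N) (map g w) p = foldr (letter_action q k n N) (map g w') p"
        by (rule foldr_letter_action_cong[OF q i0 sub count[OF law] hits[OF law] p]) (use sub in auto)
      then show "foldr (\<lambda>x. letter_action q k n N (g x)) w p = foldr (\<lambda>x. letter_action q k n N (g x)) w' p"
        by (simp add: foldr_map comp_def)
    qed
  qed
  then show ?thesis using is_groupoid_witness[of q k n N] q by (simp add: variety_n_def)
qed

theorem theorem1p2: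
  fixes G :: "('g, 'm) monoid_scheme" and S :: "'s set" and \<alpha> :: "'g \<Rightarrow> 's \<Rightarrow> 's"
  assumes "group G" and "finite (carrier G)" and "finite S"
    and "faithful_action G S \<alpha>"
    and "\<not> nilpotent_group G"
  shows "inherently_nonfinitely_based_finite_sense (automatic_algebra G S \<alpha>)"
proof -
  interpret group G by fact
  interpret F: faithful_action G S \<alpha> by fact
  \<comment> \<open>A group acting faithfully on the empty set is trivial, hence nilpotent.\<close>
  have "S \<noteq> {}"
  proof
    assume "S = {}"
    then have "\<alpha> g = \<alpha> \<one>\<^bsub>G\<^esub>" if "g \<in> carrier G" for g
      using F.bij_prop0[OF that] F.bij_prop0[OF one_closed] by (auto simp: Bij_def extensional_def)
    then have "g = \<one>\<^bsub>G\<^esub>" if "g \<in> carrier G" for g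
      using F.faithful that one_closed by (metis inj_onD)
    then have "lower_central_series G 0 = {\<one>\<^bsub>G\<^esub>}" by auto
    then show False using assms(1,5) unfolding nilpotent_group_def by blast
  qed
  then interpret F: nonempty_faithful_action G S \<alpha> by unfold_locales
  obtain q n :: nat where q: "prime q" and n: "n \<ge> 2"
    and count: "\<And>w w' i. group_law G w w' \<Longrightarrow> [count_list w (Suc i) = count_list w' (Suc i)] (mod q)"
    and hits: "\<And>w w' m v. group_law G w w' \<Longrightarrow> set w \<subseteq> {..m} \<Longrightarrow> set w' \<subseteq> {..m} \<Longrightarrow>
      [hits q m v w = hits q m v w'] (mod n)"
    by (rule group_law_imp_hits_cong[OF assms(2,5)]) blast
  have q1: "q > 1" by (rule prime_gt_1_nat[OF q])
  \<comment> \<open>\<open>k + 2\<close> counts the \<open>k + 1\<close> letters and one point,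
    independently of the size \<open>l\<close>, which is reached by taking \<open>l\<close>
    blocks.\<close>
  have "arbitrarily_large_finite_generated (k + 2) (variety_n (automatic_algebra G S \<alpha>) k)" if k: "k \<ge> 1" for k
    unfolding arbitrarily_large_finite_generated_def
  proof (intro allI impI)
    fix l :: nat
    let ?C = "witness q k n l"
    have C: "?C \<in> variety_n (automatic_algebra G S \<alpha>) k"
      using F.witness_in_variety_n[OF q1 _ count hits] k by simp
    have fin: "finite (carrier ?C)" by (simp add: carrier_witness finite_points)
    have gen: "generated_by_at_most (k + 2) ?C" using generated_witness[OF q1 _ n] k by simp
    have "l \<le> card {..n * l}" using n by (cases n) auto
    also have "\<dots> = card ((\<lambda>u. Pt (u, \<lambda>i\<in>{..<k}. 0)) ` {..n * l} :: (nat, nat \<times> (nat \<Rightarrow> nat)) aut_elem set)"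
      by (simp add: card_image inj_on_def)
    also have "\<dots> \<le> card (carrier ?C)"
      using q1 by (intro card_mono[OF fin]) (auto simp: carrier_witness points_def)
    finally have l: "l \<le> card (carrier ?C)" .
    obtain B :: "nat groupoid" where "B \<in> variety_n (automatic_algebra G S \<alpha>) k"
      "finite (carrier B)" "generated_by_at_most (k + 2) B" "card (carrier B) = card (carrier ?C)"
      by (rule nat_copy_of_finite_groupoid[OF C fin gen])
    then show "\<exists>B \<in> variety_n (automatic_algebra G S \<alpha>) k :: nat groupoid set.
        finite (carrier B) \<and> generated_by_at_most (k + 2) B \<and> l \<le> card (carrier B)"
      using l by (intro bexI[of _ B]) simp_all
  qed
  then show ?thesis unfolding inherently_nonfinitely_based_finite_sense_def
    by (intro allI impI) (metis le_add2 one_le_numeral order_trans)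
qed

end
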